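(* Let $n>2$, $V=\mathbb{F}_2^n$, let $g\in\mathrm{Sym}(V)$ and let $\Sigma$ be a Sylow $2$-subgroup of $\mathrm{AGL}(V)$ containing $T^g$. Then $T^g\trianglelefteq\Sigma$ if and only if $T^g\in\{T,T_\Sigma\}$.
   Context: $T=\{\sigma_v:v\in V\}$ with $\sigma_v:x\mapsto x+v$; $\mathrm{AGL}(V)$ is the affine group of $V$. For a Sylow $2$-subgroup $\Sigma$ of $\mathrm{AGL}(V)$, $T_\Sigma$ denotes the unique elementary abelian regular subgroup of $\mathrm{Sym}(V)$ that is contained in and normal in $\Sigma$ and satisfies $|T\cap T_\Sigma|=2^{n-2}$ (its existence and uniqueness is a theorem of the paper). *)

theory Defs
  imports "HOL-Algebra.Bij" "HOL-Algebra.Coset" "HOL-Computational_Algebra.Primes"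
begin

text \<open>V = F_2^n is modelled as the type 'n \<Rightarrow> bool for a finite type 'n with CARD('n) = n;
  addition is pointwise exclusive or.\<close>

definition vadd :: "('n \<Rightarrow> bool) \<Rightarrow> ('n \<Rightarrow> bool) \<Rightarrow> ('n \<Rightarrow> bool)" where
  "vadd x y = (\<lambda>i. x i \<noteq> y i)"

abbreviation SymV :: "(('n \<Rightarrow> bool) \<Rightarrow> ('n \<Rightarrow> bool)) monoid" where
  "SymV \<equiv> BijGroup UNIV"

definition transl :: "(('n \<Rightarrow> bool) \<Rightarrow> ('n \<Rightarrow> bool)) set" where
  "transl = {(\<lambda>x. vadd x v) | v. True}"

text \<open>Affine group AGL(V): x \<mapsto> A x + b with A an invertible F_2-linear map
  (over F_2, linear = additive).\<close>
definition AGL :: "(('n \<Rightarrow> bool) \<Rightarrow> ('n \<Rightarrow> bool)) set" where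
  "AGL = {(\<lambda>x. vadd (A x) b) | A b. bij A \<and> (\<forall>x y. A (vadd x y) = vadd (A x) (A y))}"

definition sylow2_AGL :: "(('n \<Rightarrow> bool) \<Rightarrow> ('n \<Rightarrow> bool)) set \<Rightarrow> bool" where
  "sylow2_AGL S \<longleftrightarrow> subgroup S SymV \<and> S \<subseteq> AGL \<and>
     card S = 2 ^ multiplicity (2::nat) (card (AGL :: (('n \<Rightarrow> bool) \<Rightarrow> ('n \<Rightarrow> bool)) set))"

definition conjS :: "(('n \<Rightarrow> bool) \<Rightarrow> ('n \<Rightarrow> bool)) set \<Rightarrow> (('n \<Rightarrow> bool) \<Rightarrow> ('n \<Rightarrow> bool))
    \<Rightarrow> (('n \<Rightarrow> bool) \<Rightarrow> ('n \<Rightarrow> bool)) set" where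
  "conjS H g = {inv\<^bsub>SymV\<^esub> g \<otimes>\<^bsub>SymV\<^esub> h \<otimes>\<^bsub>SymV\<^esub> g | h. h \<in> H}"

definition elab_regular :: "(('n \<Rightarrow> bool) \<Rightarrow> ('n \<Rightarrow> bool)) set \<Rightarrow> bool" where
  "elab_regular R \<longleftrightarrow> subgroup R SymV
     \<and> (\<forall>a\<in>R. \<forall>b\<in>R. a \<otimes>\<^bsub>SymV\<^esub> b = b \<otimes>\<^bsub>SymV\<^esub> a)
     \<and> (\<forall>a\<in>R. a \<otimes>\<^bsub>SymV\<^esub> a = \<one>\<^bsub>SymV\<^esub>)
     \<and> (\<forall>x y. \<exists>!r. r \<in> R \<and> r x = y)"

definition T_Sigma :: "(('n \<Rightarrow> bool) \<Rightarrow> ('n \<Rightarrow> bool)) set \<Rightarrow> (('n \<Rightarrow> bool) \<Rightarrow> ('n \<Rightarrow> bool)) set" where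
  "T_Sigma S = (THE R. elab_regular R \<and> R \<subseteq> S \<and> normal R (SymV\<lparr>carrier := S\<rparr>)
      \<and> card (transl \<inter> R) = 2 ^ (card (UNIV :: 'n set) - 2))"

end

(*
  If R is an elementary abelian regular group of affine maps, write its element taking 0 to v as
  x |-> x + v + M v x.  Then M is additive in both arguments, symmetric and alternating; if R is
  normal in the Sylow 2-subgroup S, conjugation by the linear parts of S makes M equivariant, and
  conjugation by translations gives M (M v w) x = 0.

  Counting fixed points of the 2-group S yields an invariant nonzero functional c, an invariant
  nonzero functional t on ker c (extended to V), and an invariant nonzero vector e in W = ker c \<inter> ker t.  The linear
  maps respecting the chain V > ker c > W > {0,e} > 0 form a 2-group normalised by S, which therefore
  lies in S because S is a maximal 2-group.  Equivariance under its transvections forces M = 0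
  (so R = T) or M v w = (c v t w + c w t v) e, and the latter M does define such a group T_Sigma.
*)
theory Submission
  imports Defs "HOL-Algebra.Sylow" "HOL-Algebra.Group_Action" "HOL-Algebra.Multiplicative_Group"
    "HOL-Library.Cardinality"
begin

section \<open>Affine maps over the two-element field\<close>

text \<open>The obstacle is that \<open>S\<close> is given only by its order, so no basis adapted to
  it is at hand. A 2-group acting on a set of odd size has a fixed point, and the nonzero
  functionals or vectors of a nonzero space are odd in number; this provides an adapted flag without
  coordinates. Maximality of \<open>S\<close> turns the flag into explicit elements of
  \<open>S\<close>, translations and three kinds of transvections, on which the later equations are
  evaluated. Invariance of \<open>t\<close> holds only on ker c, but the form c v t w + c w t v is
  invariant on all of V, because \<open>t\<close> changes by a multiple of \<open>c\<close> at most.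
  Its radical W has index 4, which is the origin of the exponent n - 2, and n > 2 leaves room for a
  nonzero \<open>e\<close> in W. The flag involves choices; the classification obtained from it
  contains the uniqueness of \<open>T_Sigma\<close>, so the resulting group does not depend on
  them.\<close>

notation vadd (infixl "+\<^sub>v" 65)

abbreviation vzero :: "'n \<Rightarrow> bool" where
  "vzero \<equiv> \<lambda>_. False"

abbreviation finv :: "('a \<Rightarrow> 'b) \<Rightarrow> 'b \<Rightarrow> 'a" where
  "finv f \<equiv> inv_into UNIV f"

definition smul :: "bool \<Rightarrow> ('n \<Rightarrow> bool) \<Rightarrow> ('n \<Rightarrow> bool)" where
  "smul b v = (if b then v else vzero)"

lemma transl_eq_range: "transl = range (\<lambda>v x. x +\<^sub>v v)"
  unfolding transl_def by blast

lemma vadd_commute: "x +\<^sub>v y = y +\<^sub>v x"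
  by (auto simp: vadd_def)

lemma vadd_assoc: "x +\<^sub>v y +\<^sub>v z = x +\<^sub>v (y +\<^sub>v z)"
  by (auto simp: vadd_def)

lemma vadd_left_commute: "x +\<^sub>v (y +\<^sub>v z) = y +\<^sub>v (x +\<^sub>v z)"
  by (auto simp: vadd_def)

lemma vadd_self [simp]: "x +\<^sub>v x = vzero"
  by (auto simp: vadd_def)

lemma vadd_left_self [simp]: "x +\<^sub>v (x +\<^sub>v y) = y"
  by (auto simp: vadd_def)

lemma vadd_right_self [simp]: "y +\<^sub>v x +\<^sub>v x = y"
  by (auto simp: vadd_def)

lemma vadd_zero [simp]: "x +\<^sub>v vzero = x" "vzero +\<^sub>v x = x"
  by (auto simp: vadd_def)

lemmas vadd_ac = vadd_commute vadd_assoc vadd_left_commute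

lemma vadd_cancel [simp]: "x +\<^sub>v y = x +\<^sub>v z \<longleftrightarrow> y = z" "y +\<^sub>v x = z +\<^sub>v x \<longleftrightarrow> y = z"
  by (metis vadd_left_self, metis vadd_right_self)

lemma vadd_eq_zero_iff [simp]: "x +\<^sub>v y = vzero \<longleftrightarrow> x = y"
  by (auto simp: vadd_def fun_eq_iff)

lemma vadd_eq_self [simp]: "x +\<^sub>v y = x \<longleftrightarrow> y = vzero" "x = x +\<^sub>v y \<longleftrightarrow> y = vzero"
  by (auto simp: vadd_def fun_eq_iff)

lemma smul_simps [simp]: "smul True v = v" "smul False v = vzero" "smul b vzero = vzero"
  by (auto simp: smul_def)

lemma smul_xor: "smul (a = (\<not> b)) v = smul a v +\<^sub>v smul b v"
  by (cases a; cases b) auto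

definition additive_map :: "(('n \<Rightarrow> bool) \<Rightarrow> ('n \<Rightarrow> bool)) \<Rightarrow> bool" where
  "additive_map A \<longleftrightarrow> (\<forall>x y. A (x +\<^sub>v y) = A x +\<^sub>v A y)"

definition functional :: "(('n \<Rightarrow> bool) \<Rightarrow> bool) \<Rightarrow> bool" where
  "functional f \<longleftrightarrow> (\<forall>x y. f (x +\<^sub>v y) = (f x \<noteq> f y))"

lemma additive_mapD: "additive_map A \<Longrightarrow> A (x +\<^sub>v y) = A x +\<^sub>v A y"
  by (simp add: additive_map_def)

lemma functionalD: "functional f \<Longrightarrow> f (x +\<^sub>v y) = (f x \<noteq> f y)"
  by (simp add: functional_def)

lemma additive_map_zero: "additive_map A \<Longrightarrow> A vzero = vzero"
  using additive_mapD[of A vzero vzero] by simp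

lemma functional_zero: "functional f \<Longrightarrow> \<not> f vzero"
  using functionalD[of f vzero vzero] by simp

lemma additive_map_smul: "additive_map A \<Longrightarrow> A (smul b x) = smul b (A x)"
  by (cases b) (auto simp: additive_map_zero)

lemma functional_smul: "functional f \<Longrightarrow> f (smul b x) = (b \<and> f x)"
  by (cases b) (auto simp: functional_zero)

section \<open>Linear parts and the affine group\<close>

definition lin :: "(('n \<Rightarrow> bool) \<Rightarrow> ('n \<Rightarrow> bool)) \<Rightarrow> ('n \<Rightarrow> bool) \<Rightarrow> ('n \<Rightarrow> bool)" where
  "lin f x = f x +\<^sub>v f vzero"

lemma affine_split: "f x = lin f x +\<^sub>v f vzero"
  by (simp add: lin_def)

lemma bij_vadd: "bij (\<lambda>x. x +\<^sub>v v)"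
  by (rule bij_betw_byWitness[where f' = "\<lambda>x. x +\<^sub>v v"]) auto

lemma bij_vadd_iff: "bij (\<lambda>x. f x +\<^sub>v v) \<longleftrightarrow> bij f"
proof -
  have *: "bij (\<lambda>x. f x +\<^sub>v v)" if "bij f" for f :: "'a \<Rightarrow> 'b \<Rightarrow> bool"
    using bij_comp[OF that bij_vadd[of v]] by (simp add: o_def)
  show ?thesis using *[of f] *[of "\<lambda>x. f x +\<^sub>v v"] by auto
qed

text \<open>The constant term of an affine map is its value at 0, so the linear part is determined
  and the existential quantifiers of the definition disappear.\<close>

lemma AGL_iff: "f \<in> AGL \<longleftrightarrow> bij f \<and> additive_map (lin f)"
proof
  assume "f \<in> AGL"
  then obtain A b where f: "f = (\<lambda>x. A x +\<^sub>v b)" and A: "bij A" "additive_map A"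
    by (auto simp: AGL_def additive_map_def)
  then have "lin f = A"
    by (auto simp: lin_def additive_map_zero vadd_ac)
  with A f show "bij f \<and> additive_map (lin f)"
    by (simp add: bij_vadd_iff)
next
  assume f: "bij f \<and> additive_map (lin f)"
  then have "bij (lin f)"
    unfolding lin_def by (simp add: bij_vadd_iff)
  with f show "f \<in> AGL"
    unfolding AGL_def additive_map_def mem_Collect_eq
    by (intro exI[of _ "lin f"] exI[of _ "f vzero"]) (auto simp: lin_def)
qed

text \<open>Only the outer map has to be affine: additivity of \<open>lin f\<close> is applied to g
  x + g 0, and the constants cancel.\<close>

lemma lin_comp: "additive_map (lin f) \<Longrightarrow> lin (f \<circ> g) = lin f \<circ> lin g"
proof
  fix x assume "additive_map (lin f)"
  then have "lin f (g x +\<^sub>v g vzero) = lin f (g x) +\<^sub>v lin f (g vzero)"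
    by (rule additive_mapD)
  then show "lin (f \<circ> g) x = (lin f \<circ> lin g) x"
    by (simp add: lin_def vadd_ac)
qed

lemma bij_lin_iff: "bij (lin f) \<longleftrightarrow> bij f"
  unfolding lin_def by (simp add: bij_vadd_iff)

lemma lin_id [simp]: "lin id = id"
  by (auto simp: lin_def)

lemma lin_additive: "additive_map A \<Longrightarrow> lin A = A"
  by (auto simp: lin_def additive_map_zero)

lemma lin_translate: "lin (\<lambda>x. f x +\<^sub>v v) = lin f"
  by (auto simp: lin_def vadd_ac)

lemma additive_map_comp: "additive_map A \<Longrightarrow> additive_map B \<Longrightarrow> additive_map (A \<circ> B)"
  by (simp add: additive_map_def)

lemma additive_map_inv: "additive_map A \<Longrightarrow> bij A \<Longrightarrow> additive_map (finv A)"
  unfolding additive_map_def by (metis bij_inv_eq_iff)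

lemma AGL_comp: "f \<in> AGL \<Longrightarrow> g \<in> AGL \<Longrightarrow> f \<circ> g \<in> AGL"
  by (simp add: AGL_iff lin_comp additive_map_comp bij_comp)

lemma AGL_id: "id \<in> AGL"
  by (simp add: AGL_iff) (simp add: additive_map_def)

section \<open>The symmetric group in terms of composition, and groups of 2-power order\<close>

lemma carrier_SymV: "carrier SymV = {f. bij f}"
  by (auto simp: BijGroup_def Bij_def)

lemma mult_SymV: "bij f \<Longrightarrow> bij g \<Longrightarrow> f \<otimes>\<^bsub>SymV\<^esub> g = f \<circ> g"
  by (auto simp: BijGroup_def Bij_def compose_def)

lemma one_SymV: "\<one>\<^bsub>SymV\<^esub> = id"
  by (auto simp: BijGroup_def)

lemma group_SymV: "group SymV"
  by (rule group_BijGroup)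

lemma inv_SymV:
  assumes "bij f"
  shows "inv\<^bsub>SymV\<^esub> f = finv f"
proof -
  interpret group SymV by (rule group_SymV)
  show ?thesis
    by (rule inv_equality)
      (use assms in \<open>auto simp: mult_SymV bij_imp_bij_inv one_SymV carrier_SymV bij_is_inj\<close>)
qed

lemma pow_SymV:
  assumes "bij f"
  shows "f [^]\<^bsub>SymV\<^esub> (k::nat) = f ^^ k"
proof (induction k)
  case 0
  interpret group SymV by (rule group_SymV)
  show ?case by (simp only: nat_pow_0 funpow.simps one_SymV)
next
  case (Suc k)
  interpret group SymV by (rule group_SymV)
  show ?case
    using Suc assms by (simp only: nat_pow_Suc) (simp add: mult_SymV bij_fn funpow_swap1 fun_eq_iff)
qed

lemma subgroup_SymV_iff:
  "subgroup H SymV \<longleftrightarrow> H \<subseteq> {f. bij f} \<and> id \<in> H \<and> (\<forall>f\<in>H. \<forall>g\<in>H. f \<circ> g \<in> H) \<and> (\<forall>f\<in>H. finv f \<in> H)"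
  (is "_ \<longleftrightarrow> ?R")
proof -
  have "subgroup H SymV \<longleftrightarrow> H \<subseteq> {f. bij f} \<and> id \<in> H \<and>
      (\<forall>f\<in>H. \<forall>g\<in>H. f \<otimes>\<^bsub>SymV\<^esub> g \<in> H) \<and> (\<forall>f\<in>H. inv\<^bsub>SymV\<^esub> f \<in> H)"
    by (auto simp only: subgroup_def carrier_SymV one_SymV)
  also have "\<dots> \<longleftrightarrow> ?R"
    by (intro conj_cong refl ball_cong) (auto simp: mult_SymV inv_SymV subset_iff)
  finally show ?thesis .
qed

lemma normal_in_subgroup_iff:
  assumes "subgroup S SymV"
  shows "normal R (SymV\<lparr>carrier := S\<rparr>) \<longleftrightarrow>
    subgroup R SymV \<and> R \<subseteq> S \<and> (\<forall>s\<in>S. \<forall>r\<in>R. s \<circ> r \<circ> finv s \<in> R)"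
proof -
  interpret group SymV by (rule group_SymV)
  interpret S: group "SymV\<lparr>carrier := S\<rparr>"
    using assms by (rule subgroup_imp_group)
  have sub: "subgroup R (SymV\<lparr>carrier := S\<rparr>) \<longleftrightarrow> subgroup R SymV \<and> R \<subseteq> S"
    using incl_subgroup[OF assms, of R] subgroup_incl[OF _ assms, of R]
      subgroup.subset[of R "SymV\<lparr>carrier := S\<rparr>"] by auto
  have bij: "\<And>f. f \<in> S \<Longrightarrow> bij f"
    using assms by (auto simp: subgroup_SymV_iff)
  have eq: "s \<otimes>\<^bsub>SymV\<lparr>carrier := S\<rparr>\<^esub> r \<otimes>\<^bsub>SymV\<lparr>carrier := S\<rparr>\<^esub> inv\<^bsub>SymV\<lparr>carrier := S\<rparr>\<^esub> s = s \<circ> r \<circ> finv s"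
    if "s \<in> S" "r \<in> S" for s r
    using that bij[of s] bij[of r]
    by (simp add: m_inv_consistent[OF assms] inv_SymV mult_SymV bij_comp bij_imp_bij_inv)
  then have conj: "(\<forall>s\<in>S. \<forall>r\<in>R. s \<otimes>\<^bsub>SymV\<lparr>carrier := S\<rparr>\<^esub> r \<otimes>\<^bsub>SymV\<lparr>carrier := S\<rparr>\<^esub>
      inv\<^bsub>SymV\<lparr>carrier := S\<rparr>\<^esub> s \<in> R) \<longleftrightarrow> (\<forall>s\<in>S. \<forall>r\<in>R. s \<circ> r \<circ> finv s \<in> R)" if "R \<subseteq> S"
    using that by (intro ball_cong refl) (simp only: eq subset_iff)
  have car: "carrier (SymV\<lparr>carrier := S\<rparr>) = S"
    by simp
  show ?thesis
    unfolding S.normal_inv_iff car sub using conj by argo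
qed

text \<open>Sylow's theorem with exponent 1 serves as Cauchy's theorem: an odd prime p dividing the
  order would give a subgroup of order p, and a nontrivial element of it would have an order
  dividing both p and a power of 2.\<close>

lemma order_power_of_2:
  assumes "group G" "finite (carrier G)"
    and pow: "\<And>x. x \<in> carrier G \<Longrightarrow> \<exists>k::nat. x [^]\<^bsub>G\<^esub> ((2::nat) ^ k) = \<one>\<^bsub>G\<^esub>"
  shows "\<exists>m. order G = 2 ^ m"
proof -
  interpret group G by fact
  have ord0: "order G \<noteq> 0"
    using assms(2) by (simp add: order_gt_0_iff_finite)
  have "p = 2" if p: "prime p" "p dvd order G" for p :: nat
  proof (rule ccontr)
    assume "p \<noteq> 2"
    obtain m where "order G = p ^ 1 * m"
      using p(2) by (auto elim: dvdE)
    then obtain H where H: "subgroup H G" "card H = p"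
      using sylow_thm[OF p(1) assms(1) _ assms(2), of 1 m] by auto
    then have "card H > 1"
      using p(1) prime_gt_1_nat by simp
    then obtain x where x: "x \<in> H" "x \<noteq> \<one>\<^bsub>G\<^esub>"
      using card_le_Suc0_iff_eq[of H] card.infinite[of H] by (metis One_nat_def not_less zero_le)
    have xG: "x \<in> carrier G"
      using x H(1) subgroup.mem_carrier by metis
    interpret HH: group "G\<lparr>carrier := H\<rparr>"
      using H(1) by (rule subgroup_imp_group)
    have "x [^]\<^bsub>G\<^esub> p = \<one>\<^bsub>G\<^esub>"
      using HH.pow_order_eq_1[of x] x H(2) nat_pow_consistent[of x p H] by (simp add: order_def)
    then have 1: "ord x dvd p"
      using xG pow_eq_id by blast
    obtain k where "x [^]\<^bsub>G\<^esub> ((2::nat) ^ k) = \<one>\<^bsub>G\<^esub>"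
      using pow xG by blast
    then have 2: "ord x dvd 2 ^ k"
      using xG pow_eq_id by blast
    have "coprime p (2 ^ k)"
      using primes_coprime[OF p(1) two_is_prime_nat \<open>p \<noteq> 2\<close>] by simp
    then have "ord x = 1"
      using 1 2 by (meson coprime_common_divisor_nat)
    then show False
      using x(2) xG ord_eq_1 by blast
  qed
  then have two: "p = 2" if "prime p" "p dvd order G" for p :: nat
    using that by blast
  obtain y where y: "order G = 2 ^ multiplicity 2 (order G) * y" "\<not> 2 dvd y"
    using multiplicity_decompose'[of "order G" "2::nat"] ord0 by auto
  have "y = 1"
  proof (rule ccontr)
    assume "y \<noteq> 1"
    then obtain p where "prime p" "p dvd y"
      using prime_factor_nat by blast
    with two[of p] y show False
      by (metis dvd_mult)
  qed
  with y(1) have "order G = 2 ^ multiplicity 2 (order G)"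
    by simp
  then show ?thesis by blast
qed

section \<open>Maximality of Sylow 2-subgroups\<close>

lemma lin_funpow: "additive_map (lin f) \<Longrightarrow> lin (f ^^ k) = lin f ^^ k"
  by (induction k) (simp_all add: lin_comp)

text \<open>Inverses come from closure under composition: the inverse of h is its power with
  exponent 2^k - 1.\<close>

lemma subgroup_of_2_elements:
  fixes H :: "(('n::finite \<Rightarrow> bool) \<Rightarrow> ('n \<Rightarrow> bool)) set"
  assumes bij: "\<And>h. h \<in> H \<Longrightarrow> bij h"
    and "id \<in> H"
    and comp: "\<And>f g. f \<in> H \<Longrightarrow> g \<in> H \<Longrightarrow> f \<circ> g \<in> H"
    and pow: "\<And>h. h \<in> H \<Longrightarrow> \<exists>k::nat. h ^^ (2 ^ k) = id"
  shows "subgroup H SymV" and "\<exists>m. card H = 2 ^ m"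
proof -
  interpret group SymV by (rule group_SymV)
  have pow_in: "h ^^ k \<in> H" if "h \<in> H" for h and k :: nat
    using that by (induction k) (auto simp: assms)
  have "finv h \<in> H" if h: "h \<in> H" for h
  proof -
    obtain k :: nat where "h ^^ (2 ^ k) = id"
      using pow h by blast
    moreover obtain j where "(2::nat) ^ k = Suc j"
      by (metis gr0_implies_Suc zero_less_numeral zero_less_power)
    ultimately have "h \<circ> (h ^^ j) = id"
      by simp
    then have "finv h = h ^^ j"
      using bij[OF h] by (metis bij_is_inj comp_assoc comp_id id_comp inv_o_cancel)
    with pow_in[OF h] show ?thesis by simp
  qed
  then show sub: "subgroup H SymV"
    using assms by (auto simp: subgroup_SymV_iff)
  have "\<exists>k::nat. h [^]\<^bsub>SymV\<lparr>carrier := H\<rparr>\<^esub> ((2::nat) ^ k) = \<one>\<^bsub>SymV\<lparr>carrier := H\<rparr>\<^esub>"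
    if "h \<in> H" for h
  proof -
    obtain k :: nat where k: "h ^^ (2 ^ k) = id"
      using pow \<open>h \<in> H\<close> by blast
    have "h [^]\<^bsub>SymV\<lparr>carrier := H\<rparr>\<^esub> ((2::nat) ^ k) = h [^]\<^bsub>SymV\<^esub> ((2::nat) ^ k)"
      by (rule nat_pow_consistent[symmetric])
    then show ?thesis
      using k bij[OF \<open>h \<in> H\<close>] by (auto simp: pow_SymV one_SymV)
  qed
  then have "\<exists>m. order (SymV\<lparr>carrier := H\<rparr>) = 2 ^ m"
    by (intro order_power_of_2) (use sub subgroup_imp_group in auto)
  then show "\<exists>m. card H = 2 ^ m"
    by (simp add: order_def)
qed

lemma sylow2_subgroupD:
  assumes "sylow2_AGL S"
  shows "subgroup S SymV" "S \<subseteq> AGL" "id \<in> S"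
    "\<And>f g. f \<in> S \<Longrightarrow> g \<in> S \<Longrightarrow> f \<circ> g \<in> S" "\<And>f. f \<in> S \<Longrightarrow> finv f \<in> S"
    "\<And>f. f \<in> S \<Longrightarrow> bij f" "\<And>f. f \<in> S \<Longrightarrow> additive_map (lin f)"
  using assms by (auto simp: sylow2_AGL_def subgroup_SymV_iff AGL_iff)

lemma sylow2_lin_inv:
  assumes S: "sylow2_AGL S" and s: "s \<in> S"
  shows "lin (finv s) (lin s x) = x" "lin s (lin (finv s) x) = x"
proof -
  note SD = sylow2_subgroupD[OF S]
  show "lin (finv s) (lin s x) = x" "lin s (lin (finv s) x) = x"
    using SD(6)[OF s] SD(7)[OF s] SD(7)[OF SD(5)[OF s]] lin_comp[of "finv s" s] lin_comp[of s "finv s"]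
    by (auto simp: fun_eq_iff bij_is_inj bij_is_surj surj_iff[THEN iffD1] dest!: fun_cong[of _ _ x])
qed

lemma subgroup_AGL: "subgroup (AGL :: (('n::finite \<Rightarrow> bool) \<Rightarrow> ('n \<Rightarrow> bool)) set) SymV"
proof -
  have "finv f \<in> AGL" if f: "f \<in> AGL" for f :: "('n \<Rightarrow> bool) \<Rightarrow> ('n \<Rightarrow> bool)"
  proof -
    have b: "bij f" "additive_map (lin f)" "bij (lin f)"
      using f by (auto simp: AGL_iff bij_lin_iff)
    have "lin f \<circ> lin (finv f) = id"
      using lin_comp[OF b(2), of "finv f"] b(1) by (simp add: bij_is_surj surj_iff[symmetric] surj_iff[THEN iffD1])
    then have "lin (finv f) = finv (lin f)"
      using b(3) by (metis bij_is_inj comp_assoc comp_id id_comp inv_o_cancel)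
    then show ?thesis
      using b by (simp add: AGL_iff additive_map_inv bij_imp_bij_inv)
  qed
  then show ?thesis
    by (auto simp: subgroup_SymV_iff AGL_id AGL_comp) (simp add: AGL_iff)
qed

text \<open>By Lagrange 2^m divides the order of \<open>AGL\<close>, so m is at most the
  multiplicity that defines the order of \<open>S\<close>.\<close>

lemma sylow2_maximal:
  fixes H S :: "(('n::finite \<Rightarrow> bool) \<Rightarrow> ('n \<Rightarrow> bool)) set"
  assumes "sylow2_AGL S" "S \<subseteq> H" "H \<subseteq> AGL" "subgroup H SymV" "card H = 2 ^ m"
  shows "H = S"
proof -
  interpret group SymV by (rule group_SymV)
  interpret A: group "SymV\<lparr>carrier := (AGL :: (('n \<Rightarrow> bool) \<Rightarrow> ('n \<Rightarrow> bool)) set)\<rparr>"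
    using subgroup_AGL by (rule subgroup_imp_group)
  have "subgroup H (SymV\<lparr>carrier := AGL\<rparr>)"
    using assms subgroup_AGL by (intro subgroup_incl)
  then have "card H dvd card (AGL :: (('n \<Rightarrow> bool) \<Rightarrow> ('n \<Rightarrow> bool)) set)"
    using A.lagrange[of H] by (metis dvd_triv_right order_def partial_object.select_convs(1)
      partial_object.surjective partial_object.update_convs(1))
  moreover have "card (AGL :: (('n \<Rightarrow> bool) \<Rightarrow> ('n \<Rightarrow> bool)) set) \<noteq> 0"
    using AGL_id by (auto simp: card_eq_0_iff)
  ultimately have "m \<le> multiplicity 2 (card (AGL :: (('n \<Rightarrow> bool) \<Rightarrow> ('n \<Rightarrow> bool)) set))"
    using assms(5) by (intro multiplicity_geI) auto
  then have "card H \<le> card S"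
    using assms by (simp add: sylow2_AGL_def)
  then show ?thesis
    using assms(2) by (metis card_seteq finite)
qed

lemma sylow2_elements:
  assumes "sylow2_AGL S" "s \<in> S"
  shows "\<exists>k::nat. s ^^ (2 ^ k) = id"
proof -
  interpret group SymV by (rule group_SymV)
  interpret S: group "SymV\<lparr>carrier := S\<rparr>"
    using assms sylow2_subgroupD(1) by (blast intro: subgroup_imp_group)
  have "s [^]\<^bsub>SymV\<lparr>carrier := S\<rparr>\<^esub> card S = \<one>\<^bsub>SymV\<lparr>carrier := S\<rparr>\<^esub>"
    using S.pow_order_eq_1[of s] assms(2) by (simp add: order_def)
  moreover have "s [^]\<^bsub>SymV\<lparr>carrier := S\<rparr>\<^esub> card S = s [^]\<^bsub>SymV\<^esub> card S"
    by (rule nat_pow_consistent[symmetric])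
  ultimately have "s ^^ card S = id"
    using sylow2_subgroupD(6)[OF assms] by (simp add: pow_SymV one_SymV)
  then show ?thesis
    using assms(1) by (auto simp: sylow2_AGL_def)
qed

text \<open>The affine maps with linear part in \<open>lin ` S\<close> times \<open>N\<close> form a 2-group containing \<open>S\<close>,
  so they coincide with it.\<close>

lemma normalised_2_group_in_sylow2:
  fixes S N :: "(('n::finite \<Rightarrow> bool) \<Rightarrow> ('n \<Rightarrow> bool)) set"
  assumes S: "sylow2_AGL S"
    and add: "\<And>n. n \<in> N \<Longrightarrow> additive_map n"
    and idN: "id \<in> N"
    and compN: "\<And>m n. m \<in> N \<Longrightarrow> n \<in> N \<Longrightarrow> m \<circ> n \<in> N"
    and powN: "\<And>n. n \<in> N \<Longrightarrow> \<exists>k::nat. n ^^ (2 ^ k) = id"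
    and norm: "\<And>s n. s \<in> S \<Longrightarrow> n \<in> N \<Longrightarrow> \<exists>n'\<in>N. n \<circ> lin s = lin s \<circ> n'"
    and f: "lin f \<in> N"
  shows "f \<in> S"
proof -
  note SD = sylow2_subgroupD[OF S]
  define H where "H = {f \<in> AGL. \<exists>s\<in>S. \<exists>n\<in>N. lin f = lin s \<circ> n}"
  have "id \<in> H"
    using AGL_id SD(3) idN by (force simp: H_def)
  have compH: "f \<circ> g \<in> H" if fg: "f \<in> H" "g \<in> H" for f g
  proof -
    obtain s n t m where *: "s \<in> S" "n \<in> N" "lin f = lin s \<circ> n" "t \<in> S" "m \<in> N" "lin g = lin t \<circ> m"
      using fg by (auto simp: H_def)
    obtain n' where n': "n' \<in> N" "n \<circ> lin t = lin t \<circ> n'"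
      using norm * by blast
    have AG: "f \<in> AGL" "g \<in> AGL"
      using fg by (auto simp: H_def)
    have "lin (f \<circ> g) = lin s \<circ> (n \<circ> lin t) \<circ> m"
      using AG * by (simp add: lin_comp AGL_iff comp_assoc)
    also have "\<dots> = lin (s \<circ> t) \<circ> (n' \<circ> m)"
      using * SD by (simp add: n' lin_comp comp_assoc)
    finally show ?thesis
      using AG SD(4)[OF *(1,4)] compN[OF n'(1) *(5)] unfolding H_def by (blast intro: AGL_comp)
  qed
  have powH: "\<exists>k::nat. f ^^ (2 ^ k) = id" if fH: "f \<in> H" for f
  proof -
    obtain s n where *: "s \<in> S" "n \<in> N" "lin f = lin s \<circ> n" "f \<in> AGL"
      using fH by (auto simp: H_def)
    \<comment> \<open>Normalisation allows all factors from \<open>N\<close> to be collected to the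
      right of the powers of \<open>lin s\<close>; at an exponent where the power of
      \<open>s\<close> is trivial, the power of \<open>lin f\<close> therefore lies in
      \<open>N\<close>.\<close>
    have mod_N: "\<exists>n'\<in>N. (lin s \<circ> n) ^^ i = lin s ^^ i \<circ> n'" for i
    proof (induction i)
      case 0
      then show ?case using idN by (intro bexI[of _ id]) simp_all
    next
      case (Suc i)
      then obtain n' where n': "n' \<in> N" "(lin s \<circ> n) ^^ i = lin s ^^ i \<circ> n'"
        by blast
      have "s ^^ i \<in> S"
        by (induction i) (simp_all only: funpow.simps SD(3,4) *(1))
      then obtain n'' where n'': "n'' \<in> N" "n \<circ> lin (s ^^ i) = lin (s ^^ i) \<circ> n''"
        using norm * by blast
      have "(lin s \<circ> n) ^^ Suc i = lin s \<circ> (n \<circ> lin s ^^ i) \<circ> n'"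
        by (simp only: funpow.simps n'(2) comp_assoc)
      also have "n \<circ> lin s ^^ i = lin s ^^ i \<circ> n''"
        using n''(2) SD(7)[OF *(1)] by (simp only: lin_funpow)
      also have "lin s \<circ> (lin s ^^ i \<circ> n'') \<circ> n' = lin s ^^ Suc i \<circ> (n'' \<circ> n')"
        by (simp only: funpow.simps comp_assoc)
      finally show ?case
        using compN[OF n''(1) n'(1)] by blast
    qed
    obtain k :: nat where k: "s ^^ (2 ^ k) = id"
      using sylow2_elements[OF S *(1)] by blast
    obtain n' where n': "n' \<in> N" "(lin s \<circ> n) ^^ (2 ^ k) = lin s ^^ (2 ^ k) \<circ> n'"
      using mod_N by blast
    obtain j :: nat where j: "n' ^^ (2 ^ j) = id"
      using powN n'(1) by blast
    have "lin f ^^ (2 ^ k) = n'"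
      using n'(2) k SD(7)[OF *(1)] *(3) by (simp flip: lin_funpow)
    moreover have "lin (f ^^ (2 ^ k * 2 ^ j)) = (lin f ^^ (2 ^ k)) ^^ (2 ^ j)"
      using *(4) by (simp add: lin_funpow AGL_iff funpow_mult)
    ultimately have linF: "lin (f ^^ (2 ^ k * 2 ^ j)) = id"
      using j by simp
    \<comment> \<open>An affine map with trivial linear part is a translation and squares to the
      identity, so one more factor 2 in the exponent is enough.\<close>
    define F where "F = f ^^ (2 ^ k * 2 ^ j)"
    have F: "F x = x +\<^sub>v F vzero" for x
      using affine_split[of F x] linF by (simp only: F_def id_apply)
    have "F (F x) = x" for x
      by (subst F, subst F) simp
    then have "f ^^ (2 ^ k * 2 ^ j) \<circ> f ^^ (2 ^ k * 2 ^ j) = id"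
      by (simp add: fun_eq_iff flip: F_def)
    then have "f ^^ (2 ^ (Suc (k + j))) = id"
      by (simp add: power_add mult_2 funpow_add)
    then show ?thesis by blast
  qed
  have SH: "S \<subseteq> H"
  proof
    fix s assume "s \<in> S"
    moreover have "lin s = lin s \<circ> id" by simp
    ultimately show "s \<in> H"
      using SD(2) idN unfolding H_def by blast
  qed
  have "subgroup H SymV" and "\<exists>m. card H = 2 ^ m"
    by (rule subgroup_of_2_elements; use \<open>id \<in> H\<close> compH powH in \<open>auto simp: H_def AGL_iff\<close>)+
  moreover have "H \<subseteq> AGL"
    by (auto simp: H_def)
  ultimately have HS: "H = S"
    using sylow2_maximal[OF S SH] by blast
  \<comment> \<open>Bijectivity of \<open>lin f\<close> follows from finite order: the exponent 2^k
    is positive, so a further power of \<open>lin f\<close> is a two-sided inverse.\<close>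
  have "bij (lin f)"
  proof -
    obtain k :: nat where "lin f ^^ (2 ^ k) = id"
      using powN f by blast
    moreover obtain j where "(2::nat) ^ k = Suc j"
      by (metis gr0_implies_Suc zero_less_numeral zero_less_power)
    ultimately have "lin f \<circ> lin f ^^ j = id" "lin f ^^ j \<circ> lin f = id"
      by (simp_all add: funpow_Suc_right[symmetric] del: funpow.simps) (simp add: funpow.simps(2))
    then show ?thesis
      by (rule o_bij[rotated])
  qed
  then have "f \<in> AGL"
    using add[OF f] by (simp add: AGL_iff bij_lin_iff)
  moreover have "lin f = lin id \<circ> lin f"
    by simp
  ultimately have "f \<in> H"
    using f SD(3) unfolding H_def by blast
  with HS show ?thesis by simp
qed

text \<open>The linear part of a translation is the identity, so \<open>{id}\<close> can be taken as
  the normalised group.\<close>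

lemma transl_subset_sylow2:
  fixes S :: "(('n::finite \<Rightarrow> bool) \<Rightarrow> ('n \<Rightarrow> bool)) set"
  assumes "sylow2_AGL S"
  shows "(\<lambda>x. x +\<^sub>v v) \<in> S"
  by (rule normalised_2_group_in_sylow2[OF assms, of "{id}"])
    (use lin_translate[of id] in \<open>auto simp: additive_map_def\<close>)

lemma lin_in_sylow2:
  fixes S :: "(('n::finite \<Rightarrow> bool) \<Rightarrow> ('n \<Rightarrow> bool)) set"
  assumes "sylow2_AGL S" "s \<in> S"
  shows "lin s \<in> S"
proof -
  have "(\<lambda>x. x +\<^sub>v s vzero) \<circ> s \<in> S"
    using assms transl_subset_sylow2 sylow2_subgroupD(4) by blast
  then show ?thesis
    by (simp add: o_def lin_def[abs_def])
qed

section \<open>Fixed points of 2-groups\<close>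

text \<open>Orbit sizes divide 2^m and add up to an odd number, so some orbit has odd size, and this
  size can only be 1.\<close>

lemma fixed_point_of_2_group:
  assumes G: "group G" and order: "order G = 2 ^ m" and X: "finite X" "odd (card X)"
    and closed: "\<And>g x. g \<in> carrier G \<Longrightarrow> x \<in> X \<Longrightarrow> act g x \<in> X"
    and one: "\<And>x. x \<in> X \<Longrightarrow> act \<one>\<^bsub>G\<^esub> x = x"
    and mult: "\<And>g h x. g \<in> carrier G \<Longrightarrow> h \<in> carrier G \<Longrightarrow> x \<in> X \<Longrightarrow>
      act (g \<otimes>\<^bsub>G\<^esub> h) x = act g (act h x)"
  shows "\<exists>x\<in>X. \<forall>g\<in>carrier G. act g x = x"
proof -
  interpret group G by fact
  \<comment> \<open>\<open>act\<close> is controlled on \<open>X\<close> only; restriction gives the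
    extensional maps of which \<open>BijGroup X\<close> consists.\<close>
  define \<phi> where "\<phi> g = restrict (act g) X" for g
  have bij: "\<phi> g \<in> Bij X" if g: "g \<in> carrier G" for g
  proof -
    have "bij_betw (act g) X X"
    proof (rule bij_betw_byWitness[where f' = "act (inv\<^bsub>G\<^esub> g)"])
      show "\<forall>x\<in>X. act (inv\<^bsub>G\<^esub> g) (act g x) = x" "\<forall>x\<in>X. act g (act (inv\<^bsub>G\<^esub> g) x) = x"
        using g one by (auto simp flip: mult)
    qed (use g closed in auto)
    then show ?thesis
      by (simp add: \<phi>_def Bij_def)
  qed
  interpret group_action G X \<phi>
  proof (intro group_action.intro group_hom.intro group_hom_axioms.intro)
    show "\<phi> \<in> hom G (BijGroup X)"
      unfolding hom_def using bij
      by (auto simp: BijGroup_def fun_eq_iff compose_def) (auto simp: \<phi>_def mult closed)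
  qed (use G group_BijGroup in auto)
  have fin: "finite (orbits G X \<phi>)"
  proof -
    have "orbits G X \<phi> = (\<lambda>x. orbit G \<phi> x) ` X"
      by (auto simp: orbits_def)
    then show ?thesis using X by simp
  qed
  have "\<exists>orb\<in>orbits G X \<phi>. odd (card orb)"
  proof (rule ccontr)
    assume "\<not> ?thesis"
    then have "even (\<Sum>orb\<in>orbits G X \<phi>. card orb)"
      by (intro dvd_sum) auto
    moreover have "(\<Sum>orb\<in>orbits G X \<phi>. card orb) = card X"
      using disjoint_sum[OF X(1), of "\<lambda>_. 1::nat"] by simp
    ultimately show False
      using X by simp
  qed
  then obtain x where x: "x \<in> X" "odd (card (orbit G \<phi> x))"
    by (auto simp: orbits_def)
  have "card (orbit G \<phi> x) dvd 2 ^ m"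
    using orbit_stabilizer_theorem[OF x(1)] order by (metis dvd_triv_left)
  then obtain i where i: "card (orbit G \<phi> x) = 2 ^ i"
    by (auto simp: divides_primepow_nat)
  with x(2) have "card (orbit G \<phi> x) = 1"
    by (cases i) auto
  then obtain y where "orbit G \<phi> x = {y}"
    by (auto simp: card_1_singleton_iff)
  then have "\<phi> g x = x" if "g \<in> carrier G" for g
    using that orbit_refl[OF x(1)] by (auto simp: orbit_def)
  then show ?thesis
    using x(1) by (auto simp: \<phi>_def)
qed

text \<open>The involution \<open>h\<close> exchanges the elements with \<open>p\<close> and those
  without. This serves both the parity counts and the halving of sizes when passing to a
  kernel.\<close>

lemma card_halving:
  assumes "finite Y" and h: "\<And>y. y \<in> Y \<Longrightarrow> h y \<in> Y" "\<And>y. y \<in> Y \<Longrightarrow> h (h y) = y"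
    and p: "\<And>y. y \<in> Y \<Longrightarrow> p (h y) \<longleftrightarrow> \<not> p y"
  shows "card Y = 2 * card {y \<in> Y. \<not> p y}"
proof -
  have "bij_betw h {y \<in> Y. p y} {y \<in> Y. \<not> p y}"
    by (rule bij_betw_byWitness[where f' = h]) (use h p in auto)
  then have "card {y \<in> Y. p y} = card {y \<in> Y. \<not> p y}"
    by (rule bij_betw_same_card)
  moreover have "card Y = card {y \<in> Y. p y} + card {y \<in> Y. \<not> p y}"
    using assms(1) by (subst card_Un_disjoint[symmetric]) (auto intro: arg_cong[of _ _ card])
  ultimately show ?thesis by simp
qed

lemma sylow2_fixed_point:
  fixes S :: "(('n::finite \<Rightarrow> bool) \<Rightarrow> ('n \<Rightarrow> bool)) set"
  assumes S: "sylow2_AGL S" and X: "finite X" "odd (card X)"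
    and closed: "\<And>s x. s \<in> S \<Longrightarrow> x \<in> X \<Longrightarrow> act s x \<in> X"
    and one: "\<And>x. x \<in> X \<Longrightarrow> act id x = x"
    and mult: "\<And>s t x. s \<in> S \<Longrightarrow> t \<in> S \<Longrightarrow> x \<in> X \<Longrightarrow> act (s \<circ> t) x = act s (act t x)"
  shows "\<exists>x\<in>X. \<forall>s\<in>S. act s x = x"
proof -
  note SD = sylow2_subgroupD[OF S]
  have "group (SymV\<lparr>carrier := S\<rparr>)"
    using group.subgroup_imp_group[OF group_SymV SD(1)] .
  moreover have "order (SymV\<lparr>carrier := S\<rparr>) =
      2 ^ multiplicity 2 (card (AGL :: (('n \<Rightarrow> bool) \<Rightarrow> ('n \<Rightarrow> bool)) set))"
    using S by (simp add: sylow2_AGL_def order_def)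
  ultimately have "\<exists>x\<in>X. \<forall>s\<in>carrier (SymV\<lparr>carrier := S\<rparr>). act s x = x"
    by (rule fixed_point_of_2_group) (use X closed one mult SD(6) in \<open>auto simp: one_SymV mult_SymV\<close>)
  then show ?thesis by simp
qed

text \<open>Adding a functional that is nonzero at \<open>k\<close> toggles the value at
  \<open>k\<close>, so the additive functionals on \<open>K\<close> are even in number, the nonzero
  ones odd, and \<open>S\<close> fixes one of the latter.\<close>

lemma invariant_functional:
  fixes S :: "(('n::finite \<Rightarrow> bool) \<Rightarrow> ('n \<Rightarrow> bool)) set"
  assumes S: "sylow2_AGL S"
    and K0: "vzero \<in> K" and K: "\<And>x y. x \<in> K \<Longrightarrow> y \<in> K \<Longrightarrow> x +\<^sub>v y \<in> K"
    and inv: "\<And>s x. s \<in> S \<Longrightarrow> x \<in> K \<Longrightarrow> lin s x \<in> K"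
    and k: "k \<in> K" "k \<noteq> vzero"
  obtains f where "\<And>x y. x \<in> K \<Longrightarrow> y \<in> K \<Longrightarrow> f (x +\<^sub>v y) = (f x \<noteq> f y)"
    "\<And>s x. s \<in> S \<Longrightarrow> x \<in> K \<Longrightarrow> f (lin s x) = f x" "\<exists>x\<in>K. f x"
proof -
  note SD = sylow2_subgroupD[OF S]
  \<comment> \<open>A functional on \<open>K\<close> is encoded as a predicate that is false off
    \<open>K\<close>, so that each one is counted once.\<close>
  define Y where "Y = {f. (\<forall>x. f x \<longrightarrow> x \<in> K) \<and> (\<forall>x\<in>K. \<forall>y\<in>K. f (x +\<^sub>v y) = (f x \<noteq> f y))}"
  define X where "X = Y - {\<lambda>_. False}"
  \<comment> \<open>The inverse makes this a left action.\<close>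
  define act where "act s f = (\<lambda>x. x \<in> K \<and> f (lin (finv s) x))" for s and f :: "('n \<Rightarrow> bool) \<Rightarrow> bool"
  obtain i where i: "k i"
    using k(2) by (auto simp: fun_eq_iff)
  define f0 where "f0 x \<longleftrightarrow> x \<in> K \<and> x i" for x
  have "card Y = 2 * card {f \<in> Y. \<not> f k}"
  proof (rule card_halving[where h = "\<lambda>f x. f x \<noteq> f0 x"])
    show "(\<lambda>x. f x \<noteq> f0 x) \<in> Y" if "f \<in> Y" for f
      using that K unfolding Y_def f0_def by (auto simp: vadd_def)
  qed (use i k in \<open>auto simp: f0_def\<close>)
  moreover have "(\<lambda>_. False) \<in> Y"
    by (auto simp: Y_def)
  then have "card Y = Suc (card X)"
    unfolding X_def using card_Suc_Diff1[of Y "\<lambda>_. False"] by simp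
  ultimately have "odd (card X)"
    by presburger
  moreover have fin: "finite X" by simp
  moreover note lin_inv = sylow2_lin_inv[OF S]
  moreover have "act s f \<in> X" if s: "s \<in> S" and f: "f \<in> X" for s f
  proof -
    have "f (lin (finv s) (x +\<^sub>v y)) = (f (lin (finv s) x) \<noteq> f (lin (finv s) y))"
      if "x \<in> K" "y \<in> K" for x y
      using that f inv[OF SD(5)[OF s]] SD(7)[OF SD(5)[OF s]]
      by (simp add: X_def Y_def additive_mapD)
    moreover obtain x where x: "f x" "x \<in> K"
      using f by (auto simp: X_def Y_def fun_eq_iff)
    then have "act s f (lin s x)"
      using lin_inv[OF s] inv[OF s] by (simp add: act_def)
    then have "act s f \<noteq> (\<lambda>_. False)"
      by (auto dest: fun_cong)
    ultimately show ?thesis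
      using K by (auto simp: X_def Y_def act_def)
  qed
  moreover have "act id f = f" if "f \<in> X" for f
    using that by (auto simp: act_def X_def Y_def fun_eq_iff)
  moreover have "act (s \<circ> t) f = act s (act t f)" if "s \<in> S" "t \<in> S" "f \<in> X" for s t f
    using that SD inv
    by (auto simp: act_def o_inv_distrib lin_comp fun_eq_iff bij_is_inj)
  ultimately obtain f where f: "f \<in> X" "\<And>s. s \<in> S \<Longrightarrow> act s f = f"
    using sylow2_fixed_point[OF S, of X act] by auto
  show thesis
  proof (rule that[of f])
    show "f (lin s x) = f x" if "s \<in> S" "x \<in> K" for s x
      using fun_cong[OF f(2)[OF that(1)], of "lin s x"] that lin_inv inv by (simp add: act_def)
  qed (use f(1) in \<open>auto simp: X_def Y_def fun_eq_iff\<close>)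
qed

text \<open>Adding \<open>w\<close> toggles a coordinate in which \<open>w\<close> is nonzero, so
  \<open>W\<close> has even size and its nonzero vectors are odd in number.\<close>

lemma invariant_vector:
  fixes S :: "(('n::finite \<Rightarrow> bool) \<Rightarrow> ('n \<Rightarrow> bool)) set"
  assumes S: "sylow2_AGL S"
    and W0: "vzero \<in> W" and W: "\<And>x y. x \<in> W \<Longrightarrow> y \<in> W \<Longrightarrow> x +\<^sub>v y \<in> W"
    and inv: "\<And>s x. s \<in> S \<Longrightarrow> x \<in> W \<Longrightarrow> lin s x \<in> W"
    and w: "w \<in> W" "w \<noteq> vzero"
  shows "\<exists>e\<in>W. e \<noteq> vzero \<and> (\<forall>s\<in>S. lin s e = e)"
proof -
  note SD = sylow2_subgroupD[OF S]
  obtain i where i: "w i"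
    using w(2) by (auto simp: fun_eq_iff)
  have "card W = 2 * card {x \<in> W. \<not> x i}"
    by (rule card_halving[where h = "\<lambda>x. x +\<^sub>v w"]) (use i w W in \<open>auto simp: vadd_def\<close>)
  moreover have "card W = Suc (card (W - {vzero}))"
    using W0 card_Suc_Diff1[of W vzero] by simp
  ultimately have "odd (card (W - {vzero}))"
    by presburger
  moreover have "lin s x \<noteq> vzero" if "s \<in> S" "x \<noteq> vzero" for s x
    using that SD(6)[OF that(1)] additive_map_zero[OF SD(7)[OF that(1)]]
      inj_eq[of "lin s" x vzero] by (simp add: bij_lin_iff bij_is_inj)
  ultimately have "\<exists>x\<in>W - {vzero}. \<forall>s\<in>S. lin s x = x"
    using inv SD(7) by (intro sylow2_fixed_point[OF S]) (auto simp: lin_comp)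
  then show ?thesis by auto
qed

section \<open>Existence of an invariant flag\<close>

lemma card_vectors: "card (UNIV :: ('n::finite \<Rightarrow> bool) set) = 2 ^ CARD('n)"
  by (simp add: card_fun)

lemma card_functional_kernel:
  fixes K :: "('n::finite \<Rightarrow> bool) set"
  assumes K: "\<And>x y. x \<in> K \<Longrightarrow> y \<in> K \<Longrightarrow> x +\<^sub>v y \<in> K"
    and f: "\<And>x y. x \<in> K \<Longrightarrow> y \<in> K \<Longrightarrow> f (x +\<^sub>v y) = (f x \<noteq> f y)" and z: "z \<in> K" "f z"
  shows "card K = 2 * card {x \<in> K. \<not> f x}"
  by (rule card_halving[where h = "\<lambda>x. x +\<^sub>v z"]) (use assms in auto)

text \<open>\<open>t_inv\<close> is confined to ker c because a functional on V with invariant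
  restriction to ker c need not be invariant itself.\<close>

locale sylow2_flag =
  fixes S :: "(('n::finite \<Rightarrow> bool) \<Rightarrow> ('n \<Rightarrow> bool)) set"
    and c t :: "('n \<Rightarrow> bool) \<Rightarrow> bool" and e :: "'n \<Rightarrow> bool"
  assumes S: "sylow2_AGL S"
    and c: "functional c" and c_nonzero: "\<exists>x. c x" and c_inv: "\<And>s x. s \<in> S \<Longrightarrow> c (lin s x) = c x"
    and t: "functional t" and t_nonzero: "\<exists>x. \<not> c x \<and> t x"
    and t_inv: "\<And>s x. s \<in> S \<Longrightarrow> \<not> c x \<Longrightarrow> t (lin s x) = t x"
    and e_nonzero: "e \<noteq> vzero" and c_e: "\<not> c e" and t_e: "\<not> t e"
    and e_inv: "\<And>s. s \<in> S \<Longrightarrow> lin s e = e"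
    and card_W: "card {x. \<not> c x \<and> \<not> t x} = 2 ^ (CARD('n) - 2)"

lemma exists_flag:
  fixes S :: "(('n::finite \<Rightarrow> bool) \<Rightarrow> ('n \<Rightarrow> bool)) set"
  assumes n: "CARD('n) > 2" and S: "sylow2_AGL S"
  obtains c t e where "sylow2_flag S c t e"
proof -
  note SD = sylow2_subgroupD[OF S]
  \<comment> \<open>With d = n - 3 the set W has 2^(d + 1) elements, hence one besides zero.\<close>
  obtain d where d: "CARD('n) = Suc (Suc (Suc d))"
    using n by (metis Suc_less_eq2 less_imp_Suc_add numeral_2_eq_2 add_Suc)
  have "\<exists>k\<in>K. k \<noteq> vzero" if "card K > 1" for K :: "('n \<Rightarrow> bool) set"
    using that by (metis card_1_singleton_iff One_nat_def card_le_Suc0_iff_eq finite not_less)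
  note nz = this
  have p: "1 < (2::nat) ^ Suc j" for j
    by (rule one_less_power) auto
  obtain k :: "'n \<Rightarrow> bool" where "k \<noteq> vzero"
    using nz[of UNIV] p[of "Suc (Suc d)"] unfolding card_vectors d by blast
  obtain c where "\<And>x y. c (x +\<^sub>v y) = (c x \<noteq> c y)"
      and c': "\<And>s x. s \<in> S \<Longrightarrow> c (lin s x) = c x" "\<exists>x. c x"
    by (rule invariant_functional[OF S, of UNIV k]) (use \<open>k \<noteq> vzero\<close> in auto)
  then have c: "functional c" "\<And>s x. s \<in> S \<Longrightarrow> c (lin s x) = c x" "\<exists>x. c x"
    by (simp_all add: functional_def)
  obtain z where z: "c z" using c(3) by blast
  define K where "K = {x. \<not> c x}"
  have cK: "card K = 2 ^ Suc (Suc d)"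
    using card_functional_kernel[of UNIV c z] z c(1) d
    by (simp add: card_vectors functional_def K_def)
  then obtain k where k: "k \<in> K" "k \<noteq> vzero"
    using nz[of K] p[of "Suc d"] unfolding cK by blast
  have K: "vzero \<in> K" "\<And>x y. x \<in> K \<Longrightarrow> y \<in> K \<Longrightarrow> x +\<^sub>v y \<in> K"
    "\<And>s x. s \<in> S \<Longrightarrow> x \<in> K \<Longrightarrow> lin s x \<in> K"
    using c by (auto simp: K_def functional_zero functionalD)
  obtain f where f: "\<And>x y. x \<in> K \<Longrightarrow> y \<in> K \<Longrightarrow> f (x +\<^sub>v y) = (f x \<noteq> f y)"
    "\<And>s x. s \<in> S \<Longrightarrow> x \<in> K \<Longrightarrow> f (lin s x) = f x" "\<exists>x\<in>K. f x"
    by (rule invariant_functional[OF S K k]) blast+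
  \<comment> \<open>\<open>f\<close> is additive on \<open>K\<close> only; x + c(x) z is the
    projection of x to \<open>K\<close> along \<open>z\<close>, so composing with it gives a
    functional on V.\<close>
  define t where "t x = f (x +\<^sub>v smul (c x) z)" for x
  have proj: "x +\<^sub>v smul (c x) z \<in> K" for x
    using c(1) z by (simp add: K_def functionalD functional_smul)
  have "functional t"
    unfolding functional_def
  proof (intro allI)
    fix x y
    have "x +\<^sub>v y +\<^sub>v smul (c (x +\<^sub>v y)) z = (x +\<^sub>v smul (c x) z) +\<^sub>v (y +\<^sub>v smul (c y) z)"
      using c(1) by (simp add: functionalD smul_xor vadd_ac)
    then show "t (x +\<^sub>v y) = (t x \<noteq> t y)"
      unfolding t_def using f(1)[OF proj proj] by metis
  qed
  have tK: "t x = f x" if "x \<in> K" for x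
    using that by (simp add: t_def K_def)
  have W: "card {x. \<not> c x \<and> \<not> t x} = 2 ^ Suc d"
  proof -
    have "{x. \<not> c x \<and> \<not> t x} = {x \<in> K. \<not> f x}"
      using tK by (auto simp: K_def)
    then show ?thesis
      using f(3) card_functional_kernel[of K f] K f(1) cK by auto
  qed
  then obtain w where w: "w \<in> {x. \<not> c x \<and> \<not> t x}" "w \<noteq> vzero"
    using nz[of "{x. \<not> c x \<and> \<not> t x}"] p[of d] unfolding W by blast
  have tinv: "t (lin s x) = t x" if "s \<in> S" "\<not> c x" for s x
    using that f(2)[of s x] tK[of x] tK[of "lin s x"] c(2) by (simp add: K_def)
  obtain e where "e \<in> {x. \<not> c x \<and> \<not> t x}" "e \<noteq> vzero" "\<And>s. s \<in> S \<Longrightarrow> lin s e = e"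
    using invariant_vector[OF S _ _ _ w] c tinv \<open>functional t\<close>
    by (auto simp: functional_zero functionalD)
  moreover have "\<exists>x. \<not> c x \<and> t x"
    using f(3) tK by (auto simp: K_def)
  moreover have "card {x. \<not> c x \<and> \<not> t x} = 2 ^ (CARD('n) - 2)"
    using W d by simp
  ultimately show thesis
    using S c \<open>functional t\<close> tinv by (intro that[of c t e] sylow2_flag.intro) auto
qed

section \<open>The exceptional normal subgroup\<close>

context sylow2_flag
begin

lemmas SD = sylow2_subgroupD[OF S]

text \<open>The conjuncts say that u induces the identity on each successive quotient of the chain V
  > ker c > W > {0, e} > 0. Bijectivity follows from \<open>unipotent_pow\<close>.\<close>

definition unipotent :: "(('n \<Rightarrow> bool) \<Rightarrow> ('n \<Rightarrow> bool)) set" where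
  "unipotent = {u. additive_map u \<and> (\<forall>x. c (u x) = c x) \<and> (\<forall>x. \<not> c x \<longrightarrow> t (u x) = t x)
     \<and> (\<forall>x. \<not> c x \<longrightarrow> \<not> t x \<longrightarrow> u x +\<^sub>v x \<in> {vzero, e}) \<and> u e = e}"

text \<open>On W both maps shift vectors by elements of {0, e}; u fixes these, so the two shifts add
  up.\<close>

lemma unipotent_comp:
  assumes u: "u \<in> unipotent" and v: "v \<in> unipotent"
  shows "u \<circ> v \<in> unipotent"
proof -
  have "u (v x) +\<^sub>v x \<in> {vzero, e}" if x: "\<not> c x" "\<not> t x" for x
  proof -
    have "v x +\<^sub>v x \<in> {vzero, e}"
      using v x by (simp add: unipotent_def)
    then have "u (v x +\<^sub>v x) = v x +\<^sub>v x"
      using u additive_map_zero by (auto simp: unipotent_def)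
    then have "u (v x) +\<^sub>v u x = v x +\<^sub>v x"
      using u by (simp add: unipotent_def additive_mapD)
    then have "u (v x) +\<^sub>v x = v x +\<^sub>v x +\<^sub>v (u x +\<^sub>v x)"
      by (metis vadd_assoc vadd_right_self vadd_commute)
    moreover have "u x +\<^sub>v x \<in> {vzero, e}"
      using u x by (simp add: unipotent_def)
    ultimately show ?thesis
      using \<open>v x +\<^sub>v x \<in> {vzero, e}\<close> by auto
  qed
  then show ?thesis
    using u v by (simp add: unipotent_def additive_map_comp)
qed

text \<open>Each application of N = u - 1 descends one step of the chain, which has four steps, so
  N^4 = 0; in characteristic 2 the fourth power of 1 + N is 1 + N^4.\<close>

lemma unipotent_pow:
  assumes u: "u \<in> unipotent"
  shows "u ^^ (2 ^ 2) = id"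
proof -
  have add: "additive_map u"
    using u by (simp add: unipotent_def)
  define N where "N x = u x +\<^sub>v x" for x
  have N_add: "additive_map N"
    using add by (simp add: N_def additive_map_def vadd_ac)
  have N0: "N vzero = vzero" "N e = vzero"
    using u add by (auto simp: N_def unipotent_def additive_map_zero)
  have c1: "\<not> c (N x)" for x
    using u c by (simp add: N_def unipotent_def functionalD)
  have "\<not> t (N (N x))" for x
    using u c1[of x] t by (simp add: N_def[of "N x"] unipotent_def functionalD)
  then have "N (N (N x)) \<in> {vzero, e}" for x
    using u c1[of "N x"] by (simp add: N_def[of "N (N x)"] unipotent_def)
  then have N4: "N (N (N (N x))) = vzero" for x
    using N0 by (metis insertE singletonD)
  have "u x = N x +\<^sub>v x" for x
    by (simp add: N_def)
  then have "u (u (u (u x))) = N (N (N (N x))) +\<^sub>v x" for x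
    using N_add by (simp add: additive_mapD vadd_ac)
  then show ?thesis
    using N4 by (simp add: fun_eq_iff numeral_eq_Suc)
qed

text \<open>The defining conditions mention only \<open>c\<close>, \<open>t\<close> on ker c, and
  \<open>e\<close>, all of which are fixed by the linear parts of \<open>S\<close>.\<close>

lemma unipotent_normalised:
  assumes s: "s \<in> S" and u: "u \<in> unipotent"
  shows "\<exists>u'\<in>unipotent. u \<circ> lin s = lin s \<circ> u'"
proof (intro bexI)
  define r where "r = finv s"
  have r: "r \<in> S" using s SD(5) by (simp add: r_def)
  have rs: "lin r (lin s x) = x" "lin s (lin r x) = x" for x
    using sylow2_lin_inv[OF S s] by (auto simp: r_def)
  let ?u' = "lin r \<circ> u \<circ> lin s"
  show "u \<circ> lin s = lin s \<circ> ?u'"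
    using rs by auto
  have "lin r (u (lin s x)) +\<^sub>v x \<in> {vzero, e}" if x: "\<not> c x" "\<not> t x" for x
  proof -
    have "u (lin s x) +\<^sub>v lin s x \<in> {vzero, e}"
      using u x s c_inv t_inv by (simp add: unipotent_def)
    then have "lin r (u (lin s x) +\<^sub>v lin s x) \<in> {vzero, e}"
      using e_inv[OF r] additive_map_zero[OF SD(7)[OF r]] by auto
    then show ?thesis
      using SD(7)[OF r] by (simp add: additive_mapD rs)
  qed
  then show "?u' \<in> unipotent"
    using u s r c_inv t_inv e_inv SD(7) by (simp add: unipotent_def additive_map_comp)
qed

lemma unipotent_in_S:
  assumes "lin f \<in> unipotent"
  shows "f \<in> S"
  using S _ _ unipotent_comp _ unipotent_normalised assms
proof (rule normalised_2_group_in_sylow2)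
  show "\<exists>k::nat. u ^^ (2 ^ k) = id" if "u \<in> unipotent" for u
    using unipotent_pow[OF that] by blast
qed (auto simp: unipotent_def additive_map_def)


section \<open>Transvections in the Sylow subgroup and the invariant alternating form\<close>

definition transvection :: "(('n \<Rightarrow> bool) \<Rightarrow> bool) \<Rightarrow> ('n \<Rightarrow> bool) \<Rightarrow> ('n \<Rightarrow> bool) \<Rightarrow> ('n \<Rightarrow> bool)" where
  "transvection f w x = x +\<^sub>v smul (f x) w"

lemma additive_map_transvection: "functional f \<Longrightarrow> additive_map (transvection f w)"
  by (simp add: additive_map_def transvection_def functionalD smul_xor vadd_ac)

text \<open>Each kind is invisible on the quotients of the chain: a shift by \<open>e\<close> is
  trivial modulo {0, e} and spares \<open>e\<close> itself; for f = c only vectors outside ker c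
  move, by an element of ker c; for f = t the vectors of W stay and the shift lies in W.\<close>

lemma transvection_in_S:
  assumes f: "functional f" "\<not> f e" and w: "\<not> c w"
    and "w = e \<or> (f = c) \<or> (f = t \<and> \<not> t w)"
  shows "transvection f w \<in> S"
proof -
  have "transvection f w \<in> unipotent"
    unfolding unipotent_def transvection_def
    using assms c t c_e t_e e_nonzero functional_zero[OF c] functional_zero[OF t] additive_map_transvection[OF f(1), of w, unfolded transvection_def[abs_def]]
    by (auto simp: functionalD functional_smul transvection_def[abs_def] vadd_ac smul_def)
  then show ?thesis
    by (intro unipotent_in_S) (simp add: lin_additive additive_map_transvection f(1))
qed

text \<open>The wedge product of \<open>c\<close> and \<open>t\<close>, an alternating form with
  radical W.\<close>

definition \<omega> :: "('n \<Rightarrow> bool) \<Rightarrow> ('n \<Rightarrow> bool) \<Rightarrow> bool" where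
  "\<omega> v w \<longleftrightarrow> ((c v \<and> t w) \<noteq> (c w \<and> t v))"

lemma \<omega>_add: "\<omega> (v +\<^sub>v v') w = (\<omega> v w \<noteq> \<omega> v' w)" "\<omega> w (v +\<^sub>v v') = (\<omega> w v \<noteq> \<omega> w v')"
  using c t by (auto simp: \<omega>_def functionalD)

lemma \<omega>_e: "\<not> \<omega> e x" "\<not> \<omega> x e"
  by (auto simp: \<omega>_def c_e t_e)

lemma \<omega>_self: "\<not> \<omega> x x"
  by (auto simp: \<omega>_def)

lemma \<omega>_sym: "\<omega> x y = \<omega> y x"
  by (auto simp: \<omega>_def)

lemma \<omega>_zero: "\<not> \<omega> vzero x" "\<not> \<omega> x vzero"
  by (auto simp: \<omega>_def functional_zero c t)

lemma \<omega>_smul_e: "\<not> \<omega> (smul b e) x" "\<not> \<omega> x (smul b e)"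
  by (auto simp: smul_def \<omega>_e \<omega>_zero)

text \<open>The functional t (lin s x) + t x vanishes on ker c, hence is a multiple of
  \<open>c\<close>, and adding a multiple of \<open>c\<close> to \<open>t\<close> leaves the wedge
  product unchanged.\<close>

lemma \<omega>_inv:
  assumes s: "s \<in> S"
  shows "\<omega> (lin s v) (lin s w) = \<omega> v w"
proof -
  obtain z where z: "c z" using c_nonzero by blast
  have "\<exists>\<kappa>. \<forall>x. t (lin s x) = (t x \<noteq> (c x \<and> \<kappa>))"
  proof (intro exI allI)
    fix x
    have "t (lin s (x +\<^sub>v smul (c x) z)) = t (x +\<^sub>v smul (c x) z)"
      using z c by (intro t_inv[OF s]) (simp add: functionalD functional_smul)
    then show "t (lin s x) = (t x \<noteq> (c x \<and> (t z \<noteq> t (lin s z))))"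
      using t SD(7)[OF s] by (auto simp: functionalD additive_mapD additive_map_smul functional_smul)
  qed
  then obtain \<kappa> where "\<And>x. t (lin s x) = (t x \<noteq> (c x \<and> \<kappa>))" by blast
  then show ?thesis
    using c_inv[OF s] by (auto simp: \<omega>_def)
qed

text \<open>The transvection with functional \<open>\<omega> v\<close> and vector \<open>e\<close>,
  followed by translation by v; the label v is the image of 0.\<close>

definition rmap :: "('n \<Rightarrow> bool) \<Rightarrow> ('n \<Rightarrow> bool) \<Rightarrow> ('n \<Rightarrow> bool)" where
  "rmap v x = x +\<^sub>v v +\<^sub>v smul (\<omega> v x) e"

definition R where "R = range rmap"

text \<open>Since \<open>e\<close> lies in the radical of \<omega>, the correction terms do not
  influence each other. Symmetry of the form then gives commutativity, and its alternation gives
  involutions.\<close>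

lemma rmap_comp: "rmap v \<circ> rmap w = rmap (v +\<^sub>v w +\<^sub>v smul (\<omega> v w) e)"
  by (rule ext) (auto simp: rmap_def \<omega>_add \<omega>_smul_e smul_xor vadd_ac)

lemma rmap_zero: "rmap vzero = id"
  by (auto simp: rmap_def \<omega>_zero)

lemma rmap_at_zero: "rmap v vzero = v"
  by (simp add: rmap_def \<omega>_zero)

lemma rmap_self: "rmap v \<circ> rmap v = id"
  by (simp add: rmap_comp rmap_zero \<omega>_self)

lemma bij_rmap: "bij (rmap v)"
  using rmap_self[of v] by (rule o_bij) (rule rmap_self)

lemma rmap_inverse: "finv (rmap v) = rmap v"
  using rmap_self[of v] by (simp add: inv_equality pointfree_idE)

lemma elab_regular_R: "elab_regular R"
proof -
  have sub: "subgroup R SymV"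
    unfolding subgroup_SymV_iff R_def
  proof (intro conjI ballI)
    show "id \<in> range rmap"
      using rmap_zero by (metis rangeI)
  qed (auto simp: bij_rmap rmap_comp rmap_inverse)
  have "\<exists>!r. r \<in> R \<and> r x = y" for x y
  proof (intro ex1I)
    \<comment> \<open>To solve x + v + \<omega>(v, x) e = y for v, pair both sides with x: this
      gives \<omega>(v, x) = \<omega>(x, y), after which v is explicit.\<close>
    let ?v = "x +\<^sub>v y +\<^sub>v smul (\<omega> x y) e"
    have "rmap ?v x = y"
      by (simp add: rmap_def \<omega>_add \<omega>_self \<omega>_smul_e \<omega>_sym[of y x] vadd_ac)
    then show "rmap ?v \<in> R \<and> rmap ?v x = y"
      by (simp add: R_def)
    fix r assume "r \<in> R \<and> r x = y"
    then obtain v where r: "r = rmap v" "rmap v x = y"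
      by (auto simp: R_def)
    then have y: "y = x +\<^sub>v v +\<^sub>v smul (\<omega> v x) e"
      by (simp add: rmap_def)
    have "\<omega> x y = \<omega> v x"
      unfolding y by (simp add: \<omega>_add \<omega>_self \<omega>_smul_e \<omega>_sym[of x v])
    then have "?v = v"
      unfolding y by (simp add: vadd_ac)
    then show "r = rmap ?v"
      using r by simp
  qed
  then show ?thesis
    unfolding elab_regular_def using sub
    by (auto simp: R_def mult_SymV bij_rmap one_SymV rmap_self) 
      (simp add: rmap_comp \<omega>_sym vadd_commute)
qed

lemma R_subset: "R \<subseteq> S"
proof
  fix r assume "r \<in> R"
  then obtain v where r: "r = rmap v" by (auto simp: R_def)
  have f: "functional (\<omega> v)"
    by (simp add: functional_def \<omega>_add)
  have "transvection (\<omega> v) e \<in> S"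
    by (rule transvection_in_S) (use f \<omega>_e c_e in auto)
  then have "(\<lambda>x. x +\<^sub>v v) \<circ> transvection (\<omega> v) e \<in> S"
    using transl_subset_sylow2[OF S] SD(4) by blast
  also have "(\<lambda>x. x +\<^sub>v v) \<circ> transvection (\<omega> v) e = rmap v"
    by (auto simp: rmap_def transvection_def vadd_ac)
  finally show "r \<in> S" using r by simp
qed

lemma R_conj:
  assumes s: "s \<in> S"
  shows "s \<circ> rmap v \<circ> finv s \<in> R"
proof -
  \<comment> \<open>Conjugation by the linear part turns the label v into \<open>lin s v\<close>,
    and conjugation by the translation by b = s 0 then adds \<omega>(lin s v, b) e.\<close>
  define w where "w = lin s v +\<^sub>v smul (\<omega> (lin s v) (s vzero)) e"
  have ls: "additive_map (lin s)" using SD(7)[OF s] .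
  have "s (rmap v x) = rmap w (s x)" for x
  proof -
    have "\<omega> w (s x) = (\<omega> v x \<noteq> \<omega> (lin s v) (s vzero))"
      using \<omega>_inv[OF s, of v x] by (simp add: w_def \<omega>_add \<omega>_smul_e affine_split[of s x])
    then have "rmap w (s x) = lin s x +\<^sub>v s vzero +\<^sub>v lin s v +\<^sub>v smul (\<omega> v x) e"
      by (simp add: rmap_def w_def smul_xor vadd_ac affine_split[of s x])
    also have "\<dots> = s (rmap v x)"
      by (subst affine_split[of s "rmap v x"]) (simp add: rmap_def additive_mapD[OF ls] additive_map_smul[OF ls]
        e_inv[OF s] vadd_ac)
    finally show ?thesis by simp
  qed
  then have "s \<circ> rmap v = rmap w \<circ> s" by auto
  then have "s \<circ> rmap v \<circ> finv s = rmap w"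
    using SD(6)[OF s] by (simp add: comp_assoc bij_is_surj surj_iff[THEN iffD1])
  then show ?thesis by (simp add: R_def)
qed

lemma normal_R: "normal R (SymV\<lparr>carrier := S\<rparr>)"
  using elab_regular_R R_subset R_conj
  by (auto simp: normal_in_subgroup_iff[OF SD(1)] elab_regular_def R_def)

text \<open>\<open>rmap v\<close> is a translation exactly if v lies in the radical W: testing
  \<open>\<omega> v\<close> at \<open>y\<close> and at \<open>z\<close> forces c v and t v to
  vanish.\<close>

lemma card_transl_Int_R: "card (transl \<inter> R) = 2 ^ (CARD('n) - 2)"
proof -
  obtain z y where zy: "c z" "\<not> c y" "t y" using c_nonzero t_nonzero by blast
  have "rmap v \<in> transl \<longleftrightarrow> \<not> c v \<and> \<not> t v" for v
  proof
    assume "rmap v \<in> transl"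
    then obtain w where w: "\<And>x. rmap v x = x +\<^sub>v w"
      by (auto simp: transl_def fun_eq_iff)
    then have "w = v"
      using rmap_at_zero[of v] by simp
    then have sm: "smul (\<omega> v x) e = vzero" for x
      using w[of x] by (simp add: rmap_def vadd_assoc)
    have "\<not> \<omega> v x" for x
      using e_nonzero sm[of x] by (cases "\<omega> v x") auto
    from this[of z] this[of y] show "\<not> c v \<and> \<not> t v"
      using zy by (auto simp: \<omega>_def)
  next
    assume "\<not> c v \<and> \<not> t v"
    then have "rmap v = (\<lambda>x. x +\<^sub>v v)"
      by (auto simp: rmap_def \<omega>_def)
    then show "rmap v \<in> transl"
      by (auto simp: transl_def)
  qed
  then have "transl \<inter> R = rmap ` {x. \<not> c x \<and> \<not> t x}"
    by (auto simp: R_def)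
  moreover have "inj rmap"
    by (rule inj_on_inverseI[where g = "\<lambda>f. f vzero"]) (rule rmap_at_zero)
  ultimately show ?thesis
    by (simp add: card_image card_W inj_on_subset)
qed

end

section \<open>Classification of the normal elementary abelian regular subgroups\<close>

locale normal_regular = sylow2_flag S c t e
  for S :: "(('n::finite \<Rightarrow> bool) \<Rightarrow> ('n \<Rightarrow> bool)) set" and c t e +
  fixes Q :: "(('n \<Rightarrow> bool) \<Rightarrow> ('n \<Rightarrow> bool)) set"
  assumes regular: "elab_regular Q" and normal: "normal Q (SymV\<lparr>carrier := S\<rparr>)"
begin

lemma Q_subgroup: "subgroup Q SymV" and Q_subset: "Q \<subseteq> S"
  and Q_conj: "s \<in> S \<Longrightarrow> r \<in> Q \<Longrightarrow> s \<circ> r \<circ> finv s \<in> Q"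
  using normal by (auto simp: normal_in_subgroup_iff[OF SD(1)])

lemma Q_bij: "r \<in> Q \<Longrightarrow> bij r"
  using Q_subgroup by (auto simp: subgroup_SymV_iff)

lemma Q_unique: "\<exists>!r. r \<in> Q \<and> r x = y"
  using regular by (simp add: elab_regular_def)

section \<open>The bilinear map attached to a normal regular subgroup\<close>

definition q :: "('n \<Rightarrow> bool) \<Rightarrow> ('n \<Rightarrow> bool) \<Rightarrow> ('n \<Rightarrow> bool)" where
  "q v = (THE r. r \<in> Q \<and> r vzero = v)"

definition M :: "('n \<Rightarrow> bool) \<Rightarrow> ('n \<Rightarrow> bool) \<Rightarrow> ('n \<Rightarrow> bool)" where
  "M v x = lin (q v) x +\<^sub>v x"

lemma q_in: "q v \<in> Q" and q_zero: "q v vzero = v"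
  using theI'[OF Q_unique[of vzero v]] by (auto simp: q_def)

lemma q_unique: "r \<in> Q \<Longrightarrow> r vzero = v \<Longrightarrow> r = q v"
  using Q_unique[of vzero v] q_in[of v] q_zero[of v] by blast

lemma Q_eq: "Q = range q"
  using q_in q_unique by blast

lemma q_eq: "q v x = x +\<^sub>v v +\<^sub>v M v x"
  by (simp add: M_def lin_def q_zero vadd_ac)

lemma q_commute: "q v (q w x) = q w (q v x)"
proof -
  have "q v \<otimes>\<^bsub>SymV\<^esub> q w = q w \<otimes>\<^bsub>SymV\<^esub> q v"
    using regular q_in by (simp add: elab_regular_def)
  then show ?thesis
    using q_in Q_bij by (auto simp: mult_SymV dest: fun_cong[of _ _ x])
qed

lemma q_involution: "q v (q v x) = x"
proof -
  have "q v \<otimes>\<^bsub>SymV\<^esub> q v = id"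
    using regular q_in by (simp add: elab_regular_def one_SymV)
  then show ?thesis
    using q_in Q_bij by (auto simp: mult_SymV dest: fun_cong[of _ _ x])
qed

lemma M_add_right: "M v (x +\<^sub>v y) = M v x +\<^sub>v M v y"
proof -
  have "additive_map (lin (q v))"
    using SD(7) q_in Q_subset by blast
  then show ?thesis
    by (simp add: M_def additive_mapD vadd_ac)
qed

text \<open>Commutativity of \<open>q v\<close> and \<open>q w\<close> is evaluated at 0, where they
  take the values v and w; \<open>M_self\<close> arises in the same way from involutivity.\<close>

lemma M_commute: "M v w = M w v"
  using q_commute[of v w vzero] by (simp add: q_zero) (simp add: q_eq vadd_ac)

lemma M_add_left: "M (x +\<^sub>v y) v = M x v +\<^sub>v M y v"
  by (simp add: M_commute[of _ v] M_add_right)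

lemma M_self: "M v v = vzero"
  using q_involution[of v vzero] by (simp add: q_zero) (simp add: q_eq vadd_ac)

lemma M_zero: "M v vzero = vzero" "M vzero v = vzero"
  using M_add_right[of v vzero vzero] M_commute[of v vzero] by auto

lemma M_smul: "M (smul b v) w = smul b (M v w)" "M v (smul b w) = smul b (M v w)"
  by (auto simp: smul_def M_zero)

text \<open>The linear part of \<open>s\<close> lies in \<open>S\<close> and fixes 0, so it
  conjugates \<open>q v\<close> to the element of \<open>Q\<close> that takes 0 to
  \<open>lin s v\<close>.\<close>

lemma M_equivariant:
  assumes "s \<in> S"
  shows "M (lin s v) (lin s x) = lin s (M v x)"
proof -
  let ?s = "lin s"
  have s: "?s \<in> S" using lin_in_sylow2[OF S assms] .
  have add: "additive_map ?s" using SD(7)[OF assms] .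
  have bij: "bij ?s" using SD(6)[OF s] .
  have inv0: "finv ?s vzero = vzero"
    using additive_map_zero[OF add] bij by (metis bij_inv_eq_iff)
  have "?s \<circ> q v \<circ> finv ?s = q (?s v)"
    by (rule q_unique) (use Q_conj[OF s q_in] in \<open>simp_all add: inv0 q_zero\<close>)
  from fun_cong[OF this, of "?s x"] have "?s (q v x) = q (?s v) (?s x)"
    using bij by (simp add: bij_is_inj)
  then show ?thesis
    by (simp add: q_eq additive_mapD[OF add])
qed

text \<open>Normality under the translations forces all triple products to vanish.\<close>

lemma M_M: "M (M v w) x = vzero"
proof -
  let ?s = "\<lambda>x. x +\<^sub>v w"
  have inv: "finv ?s = ?s"
    by (rule inv_equality) auto
  \<comment> \<open>The conjugate takes 0 to q v w + w, which is v + M v w; this identifies it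
    within \<open>Q\<close>.\<close>
  have "?s \<circ> q v \<circ> ?s = q (v +\<^sub>v M v w)"
    using Q_conj[OF transl_subset_sylow2[OF S] q_in, of w v] unfolding inv
    by (intro q_unique) (simp_all add: q_eq[of v w] vadd_ac)
  from fun_cong[OF this, of x] show ?thesis
    by (simp add: q_eq M_add_left M_add_right) (simp add: vadd_ac)
qed

section \<open>Restrictions on the bilinear map from transvections\<close>

lemma M_transvection:
  assumes "functional f" "\<not> f e" "\<not> c w" "w = e \<or> (f = c) \<or> (f = t \<and> \<not> t w)"
  shows "M (x +\<^sub>v smul (f x) w) (y +\<^sub>v smul (f y) w) = M x y +\<^sub>v smul (f (M x y)) w"
  using M_equivariant[OF transvection_in_S[OF assms], of x y]
  by (simp add: lin_additive additive_map_transvection assms(1)) (simp add: transvection_def)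

text \<open>If no single coordinate separates m from \<open>e\<close>, then m is supported inside
  \<open>e\<close>; the sum of a coordinate in m and one in \<open>e\<close> but not in m vanishes
  at \<open>e\<close> and not at m.\<close>

lemma separating_functional:
  assumes "m \<noteq> vzero" "m \<noteq> e"
  obtains f where "functional f" "\<not> f e" "f m"
proof (cases "\<exists>j. m j \<and> \<not> e j")
  case True
  then obtain j where "m j" "\<not> e j" by blast
  then show thesis
    by (intro that[of "\<lambda>x. x j"]) (auto simp: functional_def vadd_def)
next
  case False
  moreover obtain i where "m i"
    using assms(1) by (auto simp: fun_eq_iff)
  moreover obtain j where "m j \<noteq> e j"
    using assms(2) by (auto simp: fun_eq_iff)
  ultimately show thesis
    by (intro that[of "\<lambda>x. x i \<noteq> x j"]) (auto simp: functional_def vadd_def)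
qed

text \<open>If M v w differs from \<open>e\<close>, a transvection along \<open>e\<close> that moves
  M v w exhibits M v w + e as another value of \<open>M\<close>. By \<open>M_M\<close> both values
  annihilate everything, and so does their sum \<open>e\<close>.\<close>

lemma M_e:
  assumes "M v w \<noteq> vzero"
  shows "M e x = vzero"
proof (cases "M v w = e")
  case True
  then show ?thesis using M_M by metis
next
  case False
  then obtain f where f: "functional f" "\<not> f e" "f (M v w)"
    using separating_functional assms by metis
  have "M (v +\<^sub>v smul (f v) e) (w +\<^sub>v smul (f w) e) = M v w +\<^sub>v e"
    using M_transvection[OF f(1,2) c_e, of v w] f(3) by simp
  then have "M (M v w +\<^sub>v e) x = vzero"
    using M_M by metis
  then show ?thesis
    by (simp add: M_add_left M_M)
qed

text \<open>A suitable transvection along \<open>e\<close> would shift any other value by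
  \<open>e\<close>, although it changes the arguments only by multiples of \<open>e\<close>, which
  \<open>M\<close> ignores by \<open>M_e\<close>.\<close>

lemma M_values: "M v w \<in> {vzero, e}"
proof (rule ccontr)
  assume *: "M v w \<notin> {vzero, e}"
  then obtain f where f: "functional f" "\<not> f e" "f (M v w)"
    using separating_functional by (metis insertCI)
  have e: "M e x = vzero" "M x e = vzero" for x
    using M_e * M_commute by (metis insertCI)+
  have "M v w +\<^sub>v e = M v w"
    using M_transvection[OF f(1,2) c_e, of v w] f(3)
    by (simp add: M_add_left M_add_right M_smul e)
  then show False
    using e_nonzero by simp
qed

text \<open>For c y = 1 the transvection with functional \<open>c\<close> and vector w fixes x and
  takes y to y + w, while the value M x y, a multiple of \<open>e\<close>, does not move.\<close>

lemma M_kernel_c: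
  assumes "\<not> c x" "\<not> c w"
  shows "M x w = vzero"
proof -
  obtain y where y: "c y" using c_nonzero by blast
  have "\<not> c (M x y)"
    using M_values[of x y] c_e functional_zero[OF c] by auto
  then have "M x (y +\<^sub>v w) = M x y"
    using M_transvection[OF c c_e assms(2), of x y] y assms(1) by simp
  then show ?thesis
    by (simp add: M_add_right)
qed

text \<open>The transvection with functional \<open>t\<close> and vector x takes y to y + x and
  fixes M z y. Of the extra terms in the expansion only M z x survives; the others vanish by
  \<open>M_kernel_c\<close> and \<open>M_self\<close>.\<close>

lemma M_kernel_t:
  assumes "\<not> c x" "\<not> t x"
  shows "M z x = vzero"
proof -
  obtain y where y: "\<not> c y" "t y" using t_nonzero by blast
  have "\<not> t (M z y)"
    using M_values[of z y] t_e functional_zero[OF t] by auto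
  then have "M (z +\<^sub>v smul (t z) x) (y +\<^sub>v x) = M z y"
    using M_transvection[OF t t_e assms(1), of z y] y assms(2) by simp
  then have "M z x = vzero"
    using M_kernel_c[OF assms(1) y(1)]
    by (simp add: M_add_left M_add_right M_smul M_self)
  then show ?thesis .
qed

lemma M_cases: "(\<forall>v w. M v w = vzero) \<or> (\<forall>v w. M v w = smul (\<omega> v w) e)"
proof -
  obtain z y where zy: "c z" "\<not> c y" "t y" using c_nonzero t_nonzero by blast
  \<comment> \<open>ker c is the union of W and its coset y + W, and \<open>M z\<close> vanishes on
    W.\<close>
  have 1: "M z x = smul (t x) (M z y)" if "\<not> c x" for x
  proof (cases "t x")
    case True
    then have "M z (x +\<^sub>v y) = vzero"
      using that zy c t by (intro M_kernel_t) (auto simp: functionalD)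
    then show ?thesis
      using True by (simp add: M_add_right)
  next
    case False
    then show ?thesis using that by (simp add: M_kernel_t)
  qed
  have val: "M v w = smul (\<omega> v w) (M z y)" for v w
  proof -
    \<comment> \<open>Projecting to ker c along \<open>z\<close> leaves only pairings with
      \<open>z\<close>, so the single value M z y determines \<open>M\<close>.\<close>
    define v' w' where "v' = v +\<^sub>v smul (c v) z" and "w' = w +\<^sub>v smul (c w) z"
    have v: "v = v' +\<^sub>v smul (c v) z" and w: "w = w' +\<^sub>v smul (c w) z"
      by (simp_all add: v'_def w'_def)
    have c': "\<not> c v'" "\<not> c w'"
      using zy c by (simp_all add: v'_def w'_def functionalD functional_smul)
    have "M v w = smul (c w) (M z v') +\<^sub>v smul (c v) (M z w')"
      by (subst v, subst w) (simp add: M_add_left M_add_right M_smul M_self M_kernel_c c' M_commute[of v' z]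
          vadd_commute)
    also have "\<dots> = smul (\<omega> v w) (M z y)"
      unfolding 1[OF c'(1)] 1[OF c'(2)] using t functional_zero[OF t]
      by (auto simp: v'_def w'_def \<omega>_def functionalD functional_smul smul_def)
    finally show ?thesis .
  qed
  consider "M z y = vzero" | "M z y = e"
    using M_values[of z y] by blast
  then show ?thesis
  proof cases
    case 1
    then show ?thesis using val[unfolded 1] by simp
  next
    case 2
    then show ?thesis using val[unfolded 2] by simp
  qed
qed

lemma Q_cases: "Q = transl \<or> Q = R"
  using M_cases
proof
  assume "\<forall>v w. M v w = vzero"
  then have "q = (\<lambda>v x. x +\<^sub>v v)"
    by (intro ext) (simp add: q_eq)
  then have "range q = transl"
    by (simp add: transl_eq_range)
  then have "Q = transl"
    using Q_eq by (rule trans[rotated])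
  then show ?thesis ..
next
  assume "\<forall>v w. M v w = smul (\<omega> v w) e"
  then have "q = rmap"
    by (intro ext) (simp add: q_eq rmap_def)
  then have "range q = R"
    by (simp add: R_def)
  then have "Q = R"
    using Q_eq by (rule trans[rotated])
  then show ?thesis ..
qed

end

section \<open>Translations, their conjugates, and the identification of the exceptional
  group\<close>

lemma elab_regular_transl: "elab_regular (transl :: (('n \<Rightarrow> bool) \<Rightarrow> ('n \<Rightarrow> bool)) set)"
proof -
  have bij: "bij r" if "r \<in> transl" for r :: "('n \<Rightarrow> bool) \<Rightarrow> ('n \<Rightarrow> bool)"
    using that by (auto simp: transl_def bij_vadd)
  have inv: "finv (\<lambda>x. x +\<^sub>v v) = (\<lambda>x. x +\<^sub>v v)" for v :: "'n \<Rightarrow> bool"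
    by (rule inv_equality) auto
  have comp: "(\<lambda>x. x +\<^sub>v v) \<circ> (\<lambda>x. x +\<^sub>v w) = (\<lambda>x. x +\<^sub>v (v +\<^sub>v w))" for v w :: "'n \<Rightarrow> bool"
    by (auto simp: vadd_ac)
  have id: "id = (\<lambda>x. x +\<^sub>v vzero)"
    by auto
  have "subgroup (transl :: (('n \<Rightarrow> bool) \<Rightarrow> ('n \<Rightarrow> bool)) set) SymV"
    unfolding subgroup_SymV_iff
  proof (intro conjI ballI)
    show "id \<in> (transl :: (('n \<Rightarrow> bool) \<Rightarrow> ('n \<Rightarrow> bool)) set)"
      unfolding id transl_def by blast
    show "f \<circ> g \<in> transl" if "f \<in> transl" "g \<in> transl" for f g :: "('n \<Rightarrow> bool) \<Rightarrow> ('n \<Rightarrow> bool)"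
      using that comp unfolding transl_def by blast
    show "finv f \<in> transl" if "f \<in> transl" for f :: "('n \<Rightarrow> bool) \<Rightarrow> ('n \<Rightarrow> bool)"
      using that by (auto simp: transl_def inv)
  qed (use bij in auto)
  moreover have "\<exists>!r. r \<in> transl \<and> r x = y" for x y :: "'n \<Rightarrow> bool"
  proof (intro ex1I)
    show "(\<lambda>u. u +\<^sub>v (x +\<^sub>v y)) \<in> transl \<and> x +\<^sub>v (x +\<^sub>v y) = y"
      by (auto simp: transl_def)
    show "r = (\<lambda>u. u +\<^sub>v (x +\<^sub>v y))" if "r \<in> transl \<and> r x = y" for r
      using that by (auto simp: transl_def)
  qed
  moreover have "a \<circ> b = b \<circ> a" "a \<circ> a = id" if "a \<in> transl" "b \<in> transl"
    for a b :: "('n \<Rightarrow> bool) \<Rightarrow> ('n \<Rightarrow> bool)"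
    using that by (auto simp: transl_def o_def vadd_ac)
  ultimately show ?thesis
    unfolding elab_regular_def by (simp add: mult_SymV bij one_SymV)
qed

lemma elab_regular_conjS:
  fixes g :: "('n \<Rightarrow> bool) \<Rightarrow> ('n \<Rightarrow> bool)"
  assumes H: "elab_regular H" and g: "bij g"
  shows "elab_regular (conjS H g)"
proof -
  have Hsub: "subgroup H SymV" and Hbij: "\<And>h. h \<in> H \<Longrightarrow> bij h"
    using H by (auto simp: elab_regular_def subgroup_SymV_iff)
  have Hcomm: "x \<circ> y = y \<circ> x" if "x \<in> H" "y \<in> H" for x y
  proof -
    have "x \<otimes>\<^bsub>SymV\<^esub> y = y \<otimes>\<^bsub>SymV\<^esub> x"
      using H that unfolding elab_regular_def by blast
    then show ?thesis
      using Hbij that by (simp add: mult_SymV)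
  qed
  have Hsquare: "x \<circ> x = id" if "x \<in> H" for x
  proof -
    have "x \<otimes>\<^bsub>SymV\<^esub> x = \<one>\<^bsub>SymV\<^esub>"
      using H that unfolding elab_regular_def by blast
    then show ?thesis
      using Hbij that by (simp add: mult_SymV one_SymV)
  qed
  define k where "k h = finv g \<circ> h \<circ> g" for h
  have gi: "bij (finv g)" "\<And>x. finv g (g x) = x" "\<And>x. g (finv g x) = x"
    using g by (auto simp: bij_imp_bij_inv bij_is_inj bij_is_surj surj_f_inv_f)
  have "inv\<^bsub>SymV\<^esub> g \<otimes>\<^bsub>SymV\<^esub> h \<otimes>\<^bsub>SymV\<^esub> g = k h" if "h \<in> H" for h
    using g gi Hbij[OF that] by (simp add: k_def inv_SymV mult_SymV bij_comp)
  then have conj: "conjS H g = k ` H"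
    unfolding conjS_def by force
  have k_comp: "k a \<circ> k b = k (a \<circ> b)" for a b
    by (auto simp: k_def gi)
  have k_id: "k id = id"
    by (auto simp: k_def gi)
  have k_bij: "bij (k h)" if "h \<in> H" for h
    using that Hbij g gi by (simp add: k_def bij_comp)
  have k_inv: "finv (k h) = k (finv h)" if "h \<in> H" for h
    using Hbij[OF that] g by (simp add: k_def o_inv_distrib bij_comp bij_imp_bij_inv inv_inv_eq comp_assoc)
  have Hcl: "id \<in> H" "\<And>a b. a \<in> H \<Longrightarrow> b \<in> H \<Longrightarrow> a \<circ> b \<in> H" "\<And>a. a \<in> H \<Longrightarrow> finv a \<in> H"
    using Hsub by (auto simp: subgroup_SymV_iff)
  have "subgroup (k ` H) SymV"
    unfolding subgroup_SymV_iff
  proof (intro conjI ballI)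
    show "id \<in> k ` H"
      using Hcl(1) k_id by (metis imageI)
  qed (use k_bij k_comp k_inv Hcl in auto)
  moreover have "a \<otimes>\<^bsub>SymV\<^esub> b = b \<otimes>\<^bsub>SymV\<^esub> a" if ab: "a \<in> k ` H" "b \<in> k ` H" for a b
  proof -
    obtain x y where xy: "a = k x" "b = k y" "x \<in> H" "y \<in> H"
      using ab by blast
    then show ?thesis
      using Hcomm[of x y] k_bij by (simp add: mult_SymV k_comp)
  qed
  moreover have "a \<otimes>\<^bsub>SymV\<^esub> a = \<one>\<^bsub>SymV\<^esub>" if a: "a \<in> k ` H" for a
  proof -
    obtain x where x: "a = k x" "x \<in> H"
      using a by blast
    then show ?thesis
      using Hsquare k_bij by (simp add: mult_SymV one_SymV k_comp k_id)
  qed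
  moreover have "\<exists>!r. r \<in> k ` H \<and> r x = y" for x y
  proof -
    have *: "\<exists>!h. h \<in> H \<and> h (g x) = g y"
      using H by (simp add: elab_regular_def)
    then obtain h where h: "h \<in> H" "h (g x) = g y" by blast
    have k_val: "k a x = y \<longleftrightarrow> a (g x) = g y" for a
      using gi(2)[of y] gi(3)[of "a (g x)"] by (auto simp: k_def)
    show ?thesis
      using h * k_val by (intro ex1I[of _ "k h"]) auto
  qed
  ultimately show ?thesis
    unfolding elab_regular_def conj by simp
qed

text \<open>An affine map s conjugates the translation by v to the translation by
  \<open>lin s v\<close>.\<close>

lemma normal_transl:
  fixes S :: "(('n::finite \<Rightarrow> bool) \<Rightarrow> ('n \<Rightarrow> bool)) set"
  assumes S: "sylow2_AGL S"
  shows "normal transl (SymV\<lparr>carrier := S\<rparr>)"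
proof -
  note SD = sylow2_subgroupD[OF S]
  have "s \<circ> (\<lambda>x. x +\<^sub>v v) \<circ> finv s \<in> transl" if s: "s \<in> S" for s v
  proof -
    have "s (x +\<^sub>v v) = s x +\<^sub>v lin s v" for x
      by (subst affine_split[of s "x +\<^sub>v v"])
        (simp add: additive_mapD[OF SD(7)[OF s]], simp add: lin_def vadd_ac)
    then have "s \<circ> (\<lambda>x. x +\<^sub>v v) \<circ> finv s = (\<lambda>x. x +\<^sub>v lin s v)"
      using SD(6)[OF s] by (auto simp: bij_is_surj surj_f_inv_f)
    then show ?thesis
      by (auto simp: transl_def)
  qed
  then show ?thesis
    using elab_regular_transl transl_subset_sylow2[OF S]
    by (auto simp: normal_in_subgroup_iff[OF SD(1)] elab_regular_def transl_def)
qed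

theorem mainTheorem13:
  fixes g :: "('n::finite \<Rightarrow> bool) \<Rightarrow> ('n \<Rightarrow> bool)"
    and S :: "(('n \<Rightarrow> bool) \<Rightarrow> ('n \<Rightarrow> bool)) set"
  assumes "card (UNIV :: 'n set) > 2"
    and "g \<in> carrier SymV"
    and "sylow2_AGL S"
    and "conjS transl g \<subseteq> S"
  shows "normal (conjS transl g) (SymV\<lparr>carrier := S\<rparr>) \<longleftrightarrow>
         conjS transl g \<in> {transl, T_Sigma S}"
proof -
  obtain c t e where "sylow2_flag S c t e"
    using exists_flag[OF assms(1,3)] .
  then interpret sylow2_flag S c t e .
  have cases: "Q = transl \<or> Q = R"
    if "elab_regular Q" "normal Q (SymV\<lparr>carrier := S\<rparr>)" for Q
  proof -
    interpret normal_regular S c t e Q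
      by (intro normal_regular.intro normal_regular_axioms.intro sylow2_flag_axioms that)
    show ?thesis by (rule Q_cases)
  qed
  have card_transl: "card (transl :: (('n \<Rightarrow> bool) \<Rightarrow> ('n \<Rightarrow> bool)) set) = 2 ^ CARD('n)"
  proof -
    have "inj (\<lambda>v x. x +\<^sub>v v :: 'n \<Rightarrow> bool)"
      by (rule inj_on_inverseI[where g = "\<lambda>f. f vzero"]) simp
    then show ?thesis
      by (simp add: transl_eq_range card_image card_vectors)
  qed
  \<comment> \<open>The classification supplies the uniqueness in the definite description:
    \<open>transl\<close> is excluded because it meets itself in 2^n elements rather than 2^(n -
    2).\<close>
  have "T_Sigma S = R"
    unfolding T_Sigma_def
  proof (rule the_equality)
    fix Q
    assume Q: "elab_regular Q \<and> Q \<subseteq> S \<and> normal Q (SymV\<lparr>carrier := S\<rparr>)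
      \<and> card (transl \<inter> Q) = 2 ^ (CARD('n) - 2)"
    moreover have "CARD('n) - 2 \<noteq> CARD('n)"
      using assms(1) by simp
    ultimately have "Q \<noteq> transl"
      using card_transl by auto
    with Q cases show "Q = R" by blast
  qed (use elab_regular_R R_subset normal_R card_transl_Int_R in blast)
  moreover have "elab_regular (conjS transl g)"
    using assms(2) elab_regular_transl by (intro elab_regular_conjS) (simp_all add: carrier_SymV)
  ultimately show ?thesis
    using cases normal_R normal_transl[OF assms(3)] by auto
qed

end
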